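(* Let $P$ be a finite $(3+1)$-free poset and $\lambda$ a partition. Then $$\mathfrak{J}^P_\lambda(\mathbf{u})\equiv\sum_{T\in \mathrm{SSYT}_P(\lambda)}\mathbf{u}_{\mathrm{colword}(T)}\pmod{I^P_{\mathrm{plac}}}.$$
   Context: A poset is $(3+1)$-free if it has no induced subposet isomorphic to the disjoint union of a 3-element chain and a 1-element chain. Write $a<_P b$ for strict order and $a\sim_P b$ for incomparable or equal. $\mathcal{U}_P=\mathbb{Z}\langle u_a:a\in P\rangle$ (noncommuting variables); for a word $w=w_1\cdots w_n$ in the alphabet $P$, $\mathbf{u}_w=u_{w_1}\cdots u_{w_n}$. $e^P_k(\mathbf{u})=\sum u_{a_1}\cdots u_{a_k}$ over $a_1>_P\cdots>_P a_k$ in $P$, with $e^P_0=1$ and $e^P_k=0$ for $k<0$. For a partition $\lambda$ with conjugate $\lambda'$ and $k=\lambda_1$, $\mathfrak{J}^P_\lambda(\mathbf{u})=\sum_{\pi\in S_k}\mathrm{sgn}(\pi)\,e^P_{\lambda'_1+\pi(1)-1}(\mathbf{u})\cdots e^P_{\lambda'_k+\pi(k)-k}(\mathbf{u})$. $I^P_{\mathrm{plac}}$ is the two-sided ideal generated by: $u_bu_au_c-u_bu_cu_a$ when $a<_Pb$, $c\not<_Pb$, $a<_Pc$; $u_cu_au_b-u_au_cu_b$ when $b\not<_Pa$, $b<_Pc$, $a<_Pc$; $u_cu_au_b-u_bu_cu_a$ when $a\sim_Pb$, $b\sim_Pc$, $a<_Pc$. A $P$-tableau of shape $\lambda$ is a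 map $T$ from the Young diagram $\{(r,c): 1\le c\le\lambda_r\}$ (English notation, row $r$ increasing downward) to $P$ such that each column satisfies $T(1,c)<_PT(2,c)<_P\cdots<_PT(\lambda'_c,c)$ and each row satisfies $T(r,c+1)\not<_PT(r,c)$. $\mathrm{SSYT}_P(\lambda)$ is the set of these. The column reading word $\mathrm{colword}(T)$ is obtained by reading each column from bottom to top and concatenating the columns from left to right. *)

theory Defs
  imports "HOL-Library.Poly_Mapping" "HOL-Library.FuncSet" "HOL-Combinatorics.Permutations"
begin

(* Noncommutative polynomials Z<u_a : a in P>: finitely supported integer
   functions on words (lists) over the alphabet 'a. The word w stands for the
   monomial u_w. *)
type_synonym 'a ncpoly = "'a list \<Rightarrow>\<^sub>0 int"

definition umon :: "'a list \<Rightarrow> 'a ncpoly" where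
  "umon w = Poly_Mapping.single w 1"

definition ncmul :: "'a ncpoly \<Rightarrow> 'a ncpoly \<Rightarrow> 'a ncpoly" where
  "ncmul p q = (\<Sum>v\<in>Poly_Mapping.keys p. \<Sum>w\<in>Poly_Mapping.keys q.
       Poly_Mapping.single (v @ w) (Poly_Mapping.lookup p v * Poly_Mapping.lookup q w))"

definition ncone :: "'a ncpoly" where
  "ncone = umon []"

definition ncprod :: "'a ncpoly list \<Rightarrow> 'a ncpoly" where
  "ncprod xs = foldr ncmul xs ncone"

definition ncsmult :: "int \<Rightarrow> 'a ncpoly \<Rightarrow> 'a ncpoly" where
  "ncsmult c p = ncmul (Poly_Mapping.single [] c) p"

inductive_set nc_ideal :: "'a ncpoly set \<Rightarrow> 'a ncpoly set" for G where
  gen: "g \<in> G \<Longrightarrow> g \<in> nc_ideal G"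
| zero: "0 \<in> nc_ideal G"
| add: "a \<in> nc_ideal G \<Longrightarrow> b \<in> nc_ideal G \<Longrightarrow> a + b \<in> nc_ideal G"
| mul: "a \<in> nc_ideal G \<Longrightarrow> ncmul (ncmul p a) q \<in> nc_ideal G"

definition incomp :: "'a::order \<Rightarrow> 'a \<Rightarrow> bool" where
  "incomp a b \<longleftrightarrow> \<not> a < b \<and> \<not> b < a"

definition three_plus_one_free :: "'a::order itself \<Rightarrow> bool" where
  "three_plus_one_free _ \<longleftrightarrow>
     \<not> (\<exists>a b c d :: 'a. a < b \<and> b < c \<and> incomp a d \<and> incomp b d \<and> incomp c d)"

definition plac_gens :: "('a::order) ncpoly set" where
  "plac_gens =
     {umon [b,a,c] - umon [b,c,a] | a b c. a < b \<and> \<not> c < b \<and> a < c}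
   \<union> {umon [c,a,b] - umon [a,c,b] | a b c. \<not> b < a \<and> b < c \<and> a < c}
   \<union> {umon [c,a,b] - umon [b,c,a] | a b c. incomp a b \<and> incomp b c \<and> a < c}"

definition eP :: "int \<Rightarrow> ('a::{finite,order}) ncpoly" where
  "eP k = (\<Sum>w\<in>{w :: 'a list. int (length w) = k \<and> sorted_wrt (>) w}. umon w)"

definition is_partition :: "nat list \<Rightarrow> bool" where
  "is_partition lam \<longleftrightarrow> sorted_wrt (\<ge>) lam \<and> 0 \<notin> set lam"

definition part1 :: "nat list \<Rightarrow> nat" where
  "part1 lam = (if lam = [] then 0 else hd lam)"

definition conjp :: "nat list \<Rightarrow> nat \<Rightarrow> nat" where
  "conjp lam c = length (filter (\<lambda>x. c \<le> x) lam)"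

definition Jfrak :: "nat list \<Rightarrow> ('a::{finite,order}) ncpoly" where
  "Jfrak lam = (let k = part1 lam in
     \<Sum>\<pi> | \<pi> permutes {1..k}.
        ncsmult (sign \<pi>)
          (ncprod (map (\<lambda>i. eP (int (conjp lam i) + int (\<pi> i) - int i)) [1..<k+1])))"

(* Young diagram, English notation, 1-indexed (row, column) *)
definition young :: "nat list \<Rightarrow> (nat \<times> nat) set" where
  "young lam = {(r, c). 1 \<le> r \<and> r \<le> length lam \<and> 1 \<le> c \<and> c \<le> lam ! (r - 1)}"

definition SSYT_P :: "nat list \<Rightarrow> (nat \<times> nat \<Rightarrow> 'a::order) set" where
  "SSYT_P lam = {T \<in> young lam \<rightarrow>\<^sub>E UNIV.
     (\<forall>r c. (r, c) \<in> young lam \<and> (r + 1, c) \<in> young lam \<longrightarrow> T (r, c) < T (r + 1, c)) \<and>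
     (\<forall>r c. (r, c) \<in> young lam \<and> (r, c + 1) \<in> young lam \<longrightarrow> \<not> T (r, c + 1) < T (r, c))}"

definition colword :: "nat list \<Rightarrow> (nat \<times> nat \<Rightarrow> 'a) \<Rightarrow> 'a list" where
  "colword lam T = concat (map (\<lambda>c. map (\<lambda>r. T (r, c)) (rev [1..<conjp lam c + 1]))
                               [1..<part1 lam + 1])"

end

theory Submission
  imports Defs
begin

text \<open>
  A linear functional on words that is constant on P-Knuth classes turns the claim into an identity
  of integers, which is proved by a sign-reversing injection on the terms of the determinant in the
  style of Gasharov. At the first flaw of an array of columns, Gasharov exchanges the tails \<open>A\<close> and
  \<open>B\<close> of two adjacent columns \<open>UA\<close> and \<open>VB\<close>; this does not respect P-Knuth equivalence. But the
  heads satisfy the row condition and every letter of the tails lies below every letter of the heads,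
  so \<open>UAVB \<approx> UVAB\<close>, and it suffices to replace \<open>(A, B)\<close> by some pair \<open>(A', B')\<close> of
  chains with exchanged lengths and \<open>AB \<approx> A'B'\<close>, injectively. Such a pair is found as in the
  crystal of type \<open>A\<^sub>1\<close>: the odd components of the incomparability graph of the two chains play
  the roles of brackets, and unmatched components are moved one at a time to the other chain.
\<close>

section \<open>P-Knuth equivalence of words\<close>

text \<open>By (3+1)-freeness no letter is unrelated to three letters of a chain. So in the graph of
  two chains every letter has at most two neighbours; an even component takes equally many letters
  from both chains, an odd one takes one more from one of them. Exchanging the two sides of an odd
  component changes each length by one, and \<open>q - p\<close> such moves turn lengths
  \<open>p <= q\<close> into \<open>q\<close> and \<open>p\<close>. The bracket rule selects the
  component so that each move can be undone from its result. The graph itself is never formed: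
  dropping \<open>d\<close> letters at the small end of the second chain and testing
  \<open>tab\<close> locates the component by the first position that fails. Only injectivity is
  tracked, because the flawed arrays form a finite set, on which an injective self-map is a
  permutation.\<close>

inductive pknuth :: "('a \<Rightarrow> 'a \<Rightarrow> bool) \<Rightarrow> 'a list \<Rightarrow> 'a list \<Rightarrow> bool" for lt where
  pknuth_refl: "pknuth lt w w"
| pknuth_sym: "pknuth lt v w \<Longrightarrow> pknuth lt w v"
| pknuth_trans: "pknuth lt u v \<Longrightarrow> pknuth lt v w \<Longrightarrow> pknuth lt u w"
| pknuth_swap_right: "lt a b \<Longrightarrow> \<not> lt c b \<Longrightarrow> lt a c \<Longrightarrow>
    pknuth lt (p @ [b, a, c] @ s) (p @ [b, c, a] @ s)"
| pknuth_swap_left: "\<not> lt b a \<Longrightarrow> lt b c \<Longrightarrow> lt a c \<Longrightarrow>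
    pknuth lt (p @ [c, a, b] @ s) (p @ [a, c, b] @ s)"
| pknuth_rotate: "\<not> lt a b \<Longrightarrow> \<not> lt b a \<Longrightarrow> \<not> lt b c \<Longrightarrow> \<not> lt c b \<Longrightarrow> lt a c \<Longrightarrow>
    pknuth lt (p @ [c, a, b] @ s) (p @ [b, c, a] @ s)"

declare pknuth_trans [trans]

lemma pknuth_context:
  assumes "pknuth lt u v"
  shows "pknuth lt (p @ u @ s) (p @ v @ s)"
  using assms
proof induction
  case (pknuth_swap_right a b c p' s')
  then show ?case
    using pknuth.pknuth_swap_right[of lt a b c "p @ p'" "s' @ s"] by simp
next
  case (pknuth_swap_left b a c p' s')
  then show ?case
    using pknuth.pknuth_swap_left[of lt b a c "p @ p'" "s' @ s"] by simp
next
  case (pknuth_rotate a b c p' s')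
  then show ?case
    using pknuth.pknuth_rotate[of lt a b c "p @ p'" "s' @ s"] by simp
qed (rule pknuth_refl, erule pknuth_sym, erule (1) pknuth_trans)

text \<open>Reversal together with order duality exchanges the two swap relations and maps the
  rotation to itself. This symmetry halves several later arguments.\<close>

lemma pknuth_rev:
  assumes "pknuth lt u v"
  shows "pknuth (\<lambda>a b. lt b a) (rev u) (rev v)"
  using assms
proof induction
  case (pknuth_swap_right a b c p s)
  then show ?case
    using pknuth.pknuth_swap_left[of "\<lambda>a b. lt b a" b c a "rev s" "rev p"]
    by (simp add: pknuth_sym)
next
  case (pknuth_swap_left b a c p s)
  then show ?case
    using pknuth.pknuth_swap_right[of "\<lambda>a b. lt b a" c b a "rev s" "rev p"]
    by (simp add: pknuth_sym)
next
  case (pknuth_rotate a b c p s)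
  then show ?case
    using pknuth.pknuth_rotate[of "\<lambda>a b. lt b a" c b a "rev s" "rev p"]
    by (simp add: pknuth_sym)
qed (rule pknuth_refl, erule pknuth_sym, erule (1) pknuth_trans)

text \<open>Ensures that exchanged tails consist of the old letters and hence still lie below the
  heads.\<close>

lemma pknuth_mset: "pknuth lt u v \<Longrightarrow> mset u = mset v"
  by (induction rule: pknuth.induct) auto

text \<open>The relation is a parameter instead of the class order, so that every lemma can also be
  interpreted for the dual order.\<close>

locale three_one_free_order =
  fixes lt :: "'a \<Rightarrow> 'a \<Rightarrow> bool" (infix "\<sqsubset>" 50)
  assumes lt_trans: "a \<sqsubset> b \<Longrightarrow> b \<sqsubset> c \<Longrightarrow> a \<sqsubset> c"
    and three_one: "a \<sqsubset> b \<Longrightarrow> b \<sqsubset> c \<Longrightarrow>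
      a \<sqsubset> d \<or> d \<sqsubset> a \<or> b \<sqsubset> d \<or> d \<sqsubset> b \<or> c \<sqsubset> d \<or> d \<sqsubset> c"

lemma three_one_free_order_dual:
  "three_one_free_order lt \<Longrightarrow> three_one_free_order (\<lambda>a b. lt b a)"
  unfolding three_one_free_order_def by blast

text \<open>Chains are kept as ascending lists, so the reading word of a column \<open>xs\<close> is \<open>rev xs\<close>.
  \<open>tab\<close> is the row condition for two adjacent columns aligned at their smallest entries.\<close>

fun tab :: "('a \<Rightarrow> 'a \<Rightarrow> bool) \<Rightarrow> 'a list \<Rightarrow> 'a list \<Rightarrow> bool" where
  "tab lt xs [] \<longleftrightarrow> True"
| "tab lt [] (y # ys) \<longleftrightarrow> False"
| "tab lt (x # xs) (y # ys) \<longleftrightarrow> \<not> lt y x \<and> tab lt xs ys"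

lemma tab_iff_nth:
  "tab lt xs ys \<longleftrightarrow> length ys \<le> length xs \<and> (\<forall>j<length ys. \<not> lt (ys ! j) (xs ! j))"
proof (induction lt xs ys rule: tab.induct)
  case (3 lt x xs y ys)
  show ?case
    unfolding tab.simps 3 by (auto simp: less_Suc_eq_0_disj)
qed auto

lemma tab_append:
  "length a = length b \<Longrightarrow> tab lt a b \<Longrightarrow> tab lt c e \<Longrightarrow> tab lt (a @ c) (b @ e)"
  by (induction a b rule: list_induct2) auto

definition pair_word :: "'a list \<times> 'a list \<Rightarrow> 'a list" where
  "pair_word z = rev (fst z) @ rev (snd z)"

section \<open>Moving a chain past an adjacent column\<close>

context three_one_free_order
begin

abbreviation pk (infix "\<approx>" 50) where "u \<approx> v \<equiv> pknuth lt u v"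
abbreviation "chain xs \<equiv> sorted_wrt lt xs"

text \<open>After the shift each letter of \<open>ys\<close> faces a smaller letter than before,
  which only weakens the row condition.\<close>

lemma tab_Cons_left:
  assumes "chain (x # xs)" "chain ys" "tab lt xs ys"
  shows "tab lt (x # xs) ys"
proof -
  have "\<not> ys ! j \<sqsubset> (x # xs) ! j" if "j < length ys" for j
  proof
    assume *: "ys ! j \<sqsubset> (x # xs) ! j"
    have j: "j < length xs" "\<not> ys ! j \<sqsubset> xs ! j"
      using assms(3) that by (auto simp: tab_iff_nth)
    have "(x # xs) ! j \<sqsubset> (x # xs) ! Suc j"
      using sorted_wrt_nth_less[OF assms(1), of j "Suc j"] j by simp
    from lt_trans[OF * this] j show False by simp
  qed
  then show ?thesis using assms(3) by (simp add: tab_iff_nth)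
qed

lemma tab_append_left:
  "chain (cs @ xs) \<Longrightarrow> chain ys \<Longrightarrow> tab lt xs ys \<Longrightarrow> tab lt (cs @ xs) ys"
proof (induction cs)
  case (Cons c cs)
  then show ?case using tab_Cons_left[of c "cs @ xs" ys] by simp
qed simp

lemma tab_tl:
  assumes "chain xs" "chain (y # ys)" "tab lt xs (y # ys)"
  shows "tab lt xs ys"
proof (cases xs)
  case (Cons x xs')
  then show ?thesis using assms by (intro tab_Cons_left[of x xs' ys, folded Cons]) auto
qed (use assms in auto)

text \<open>The second claim, that \<open>x\<close> can be moved to the end, is what allows \<open>c\<close> to pass
  the smallest letter of the second column by a Knuth relation with \<open>x\<close>. It cannot claim
  \<open>Z = rev xs @ rev ys\<close>, since \<open>x\<close> need not lie below the first letter of \<open>ys\<close>.\<close>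

lemma pass_below_aux:
  "(\<forall>xs ys c. length ys = n \<longrightarrow> chain xs \<longrightarrow> chain ys \<longrightarrow> tab lt xs ys \<longrightarrow>
     (\<forall>z\<in>set xs \<union> set ys. c \<sqsubset> z) \<longrightarrow> rev xs @ [c] @ rev ys \<approx> rev xs @ rev ys @ [c]) \<and>
   (\<forall>x xs y ys. length ys = n \<longrightarrow> chain (x # xs) \<longrightarrow> chain (y # ys) \<longrightarrow>
     tab lt (x # xs) (y # ys) \<longrightarrow> (\<exists>Z. rev xs @ [x] @ rev ys \<approx> Z @ [x]))"
proof (induction n rule: less_induct)
  case (less n)
  have R: "rev xs @ [c] @ rev ys \<approx> rev xs @ rev ys @ [c]"
    if "length ys < n" "chain xs" "chain ys" "tab lt xs ys" "\<forall>z\<in>set xs \<union> set ys. c \<sqsubset> z" for xs ys c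
    using less that by blast
  have R': "\<exists>Z. rev xs @ [x] @ rev ys \<approx> Z @ [x]"
    if "length ys < n" "chain (x # xs)" "chain (y # ys)" "tab lt (x # xs) (y # ys)" for x xs y ys
    using less that by blast
  have R_n: "rev xs @ [c] @ rev ys \<approx> rev xs @ rev ys @ [c]"
    if ys: "length ys = n" "chain xs" "chain ys" "tab lt xs ys" "\<forall>z\<in>set xs \<union> set ys. c \<sqsubset> z" for xs ys c
  proof (cases ys)
    case Nil
    then show ?thesis by (simp add: pknuth_refl)
  next
    case (Cons y1 ys')
    then obtain x1 xs' where xs: "xs = x1 # xs'" using ys by (cases xs) auto
    have len: "length ys' < n" using ys Cons by auto
    obtain Z where Z: "rev xs' @ [x1] @ rev ys' \<approx> Z @ [x1]"
      using R'[OF len, of x1 xs' y1] ys xs Cons by auto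
    have t: "tab lt xs ys'" using tab_tl ys Cons by auto
    have "rev xs @ [c] @ rev ys' \<approx> rev xs @ rev ys' @ [c]"
      using R[OF len _ _ t] ys Cons by auto
    from pknuth_context[OF this, of "[]" "[y1]"]
    have "rev xs @ [c] @ rev ys \<approx> rev xs' @ [x1] @ rev ys' @ [c, y1]" using Cons xs by simp
    also have "rev xs' @ [x1] @ rev ys' @ [c, y1] \<approx> Z @ [x1, c, y1]"
      using pknuth_context[OF Z, of "[]" "[c, y1]"] by simp
    also have "Z @ [x1, c, y1] \<approx> Z @ [x1, y1, c]"
      using pknuth_swap_right[of lt c x1 y1 Z "[]"] ys Cons xs by auto
    also have "Z @ [x1, y1, c] \<approx> rev xs' @ [x1] @ rev ys' @ [y1, c]"
      using pknuth_context[OF pknuth_sym[OF Z], of "[]" "[y1, c]"] by simp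
    finally show ?thesis using Cons xs by simp
  qed
  have R'_n: "\<exists>Z. rev xs @ [x] @ rev ys \<approx> Z @ [x]"
    if ys: "length ys = n" "chain (x # xs)" "chain (y # ys)" "tab lt (x # xs) (y # ys)" for x xs y ys
  proof (cases ys)
    case Nil
    then show ?thesis by (auto intro: pknuth_refl)
  next
    case (Cons y2 ys'')
    then obtain x2 xs'' where xs: "xs = x2 # xs''" using ys by (cases xs) auto
    \<comment> \<open>If \<open>x\<close> lies below all of \<open>ys\<close>, the first claim at
      the same size moves it to the end. Otherwise \<open>y2\<close> is the only letter of
      \<open>ys\<close> not above \<open>x\<close>; \<open>x\<close> passes the others, and a
      rotation carries \<open>y2\<close> in front of \<open>x2\<close> and \<open>x\<close>.\<close>
    show ?thesis
    proof (cases "x \<sqsubset> y2")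
      case True
      have "rev xs @ [x] @ rev ys \<approx> rev xs @ rev ys @ [x]"
      proof (rule R_n)
        show "\<forall>z\<in>set xs \<union> set ys. x \<sqsubset> z"
          using ys True Cons lt_trans[OF True] by auto
        show "tab lt xs ys" using ys by simp
      qed (use ys in auto)
      then show ?thesis by (metis append.assoc)
    next
      case False
      have len: "length ys'' < n" using ys Cons by auto
      have o: "x \<sqsubset> x2" "y \<sqsubset> y2" "\<not> y \<sqsubset> x" "\<not> y2 \<sqsubset> x2" using ys xs Cons by auto
      have inc: "\<not> x2 \<sqsubset> y2" "\<not> y2 \<sqsubset> x" using o False lt_trans by blast+
      \<comment> \<open>Here \<open>y\<close> is needed, although it does not occur in the word:
        \<open>x\<close> is unrelated to \<open>y\<close> and \<open>y2\<close>, so by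
        (3+1)-freeness it is comparable with \<open>y3\<close>, and only from below.\<close>
      have above: "x \<sqsubset> y3" if "y3 \<in> set ys''" for y3
      proof -
        have "y2 \<sqsubset> y3" using ys(3) Cons that by simp
        moreover have "\<not> x \<sqsubset> y" "\<not> y3 \<sqsubset> x"
          using o False inc lt_trans \<open>y2 \<sqsubset> y3\<close> by blast+
        ultimately show ?thesis using three_one[OF o(2), of y3 x] o False inc by blast
      qed
      have "rev xs @ [x] @ rev ys'' \<approx> rev xs @ rev ys'' @ [x]"
      proof (rule R[OF len])
        show "tab lt xs ys''" using ys Cons tab_tl[of xs y2 ys''] by simp
      next
        show "\<forall>z\<in>set xs \<union> set ys''. x \<sqsubset> z" using ys(2) above by auto
      next
        show "chain xs" "chain ys''" using ys(2,3) Cons by simp_all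
      qed
      from pknuth_context[OF this, of "[]" "[y2]"]
      have "rev xs @ [x] @ rev ys \<approx> rev xs'' @ [x2] @ rev ys'' @ [x, y2]"
        using Cons xs by simp
      also obtain Z where "rev xs'' @ [x2] @ rev ys'' \<approx> Z @ [x2]"
        using R'[OF len, of x2 xs'' y2] ys xs Cons by auto
      from pknuth_context[OF this, of "[]" "[x, y2]"]
      have "rev xs'' @ [x2] @ rev ys'' @ [x, y2] \<approx> Z @ [x2, x, y2]" by simp
      also have "Z @ [x2, x, y2] \<approx> Z @ [y2, x2, x]"
        using pknuth_rotate[of lt x y2 x2 Z "[]"] o inc False by simp
      finally have "rev xs @ [x] @ rev ys \<approx> (Z @ [y2, x2]) @ [x]" by simp
      then show ?thesis by blast
    qed
  qed
  show ?case using R_n R'_n by blast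
qed

text \<open>The letters of \<open>cs\<close> pass \<open>ys\<close> one at a time, smallest first.
  Those still waiting extend the first column at its small end, where \<open>tab_append_left\<close>
  preserves the row condition.\<close>

lemma pass_below:
  assumes "chain (cs @ xs)" "chain ys" "tab lt xs ys"
    "\<And>c z. c \<in> set cs \<Longrightarrow> z \<in> set ys \<Longrightarrow> c \<sqsubset> z"
  shows "rev xs @ rev cs @ rev ys \<approx> rev xs @ rev ys @ rev cs"
  using assms
proof (induction cs)
  case Nil
  then show ?case by (simp add: pknuth_refl)
next
  case (Cons c cs)
  have t: "tab lt (cs @ xs) ys" using Cons.prems by (simp add: tab_append_left)
  have "rev (cs @ xs) @ [c] @ rev ys \<approx> rev (cs @ xs) @ rev ys @ [c]"
    using Cons.prems by (intro pass_below_aux[THEN conjunct1, rule_format, OF refl] t) auto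
  then have "rev xs @ rev (c # cs) @ rev ys \<approx> rev xs @ rev cs @ rev ys @ [c]" by simp
  also have "\<dots> \<approx> rev xs @ rev ys @ rev cs @ [c]"
    using pknuth_context[OF Cons.IH, of "[]" "[c]"] Cons.prems by simp
  finally show ?case by simp
qed

end

text \<open>Order duality reverses words and exchanges the two columns.\<close>

lemma (in three_one_free_order) pass_above:
  assumes "chain xs" "chain (ys @ cs)" "tab (\<lambda>a b. b \<sqsubset> a) (rev ys) (rev xs)"
    "\<And>c z. c \<in> set cs \<Longrightarrow> z \<in> set xs \<Longrightarrow> z \<sqsubset> c"
  shows "rev cs @ rev xs @ rev ys \<approx> rev xs @ rev cs @ rev ys"
proof -
  interpret d: three_one_free_order "\<lambda>a b. b \<sqsubset> a"
    by (rule three_one_free_order_dual) unfold_locales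
  have "pknuth (\<lambda>a b. b \<sqsubset> a) (rev (rev ys) @ rev (rev cs) @ rev (rev xs))
      (rev (rev ys) @ rev (rev xs) @ rev (rev cs))"
    using assms by (intro d.pass_below) (auto simp: sorted_wrt_rev sorted_wrt_append)
  from pknuth_sym[OF pknuth_rev[OF this]] show ?thesis by simp
qed

context three_one_free_order
begin

text \<open>An odd component of the incomparability graph of two chains is a path, whose vertices
  alternate between the longer chain \<open>bs\<close> and the shorter chain \<open>ss\<close>.\<close>

definition zigzag :: "'a list \<Rightarrow> 'a list \<Rightarrow> bool" where
  "zigzag bs ss \<longleftrightarrow> chain bs \<and> chain ss \<and> length bs = Suc (length ss) \<and>
     (\<forall>t<length ss. \<not> bs ! t \<sqsubset> ss ! t \<and> \<not> ss ! t \<sqsubset> bs ! t \<and>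
        \<not> bs ! Suc t \<sqsubset> ss ! t \<and> \<not> ss ! t \<sqsubset> bs ! Suc t)"

text \<open>Induction strips the smallest letters: \<open>b0\<close> passes \<open>ss\<close>, the
  shorter zigzag \<open>b1 # bs'\<close>, \<open>ss\<close> commutes by induction, a rotation turns
  \<open>b1 b0 s0\<close> into \<open>s0 b1 b0\<close>, and \<open>s0\<close> passes
  \<open>bs'\<close> to the left.\<close>

lemma zigzag_commute:
  assumes "zigzag bs ss"
  shows "rev bs @ rev ss \<approx> rev ss @ rev bs"
  using assms
proof (induction ss arbitrary: bs)
  case Nil
  then show ?case by (simp add: pknuth_refl)
next
  case (Cons s0 ss)
  obtain b0 b1 bs' where bs: "bs = b0 # b1 # bs'"
    using Cons.prems by (auto simp: zigzag_def length_Suc_conv)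
  have inc: "\<not> b0 \<sqsubset> s0" "\<not> s0 \<sqsubset> b0" "\<not> b1 \<sqsubset> s0" "\<not> s0 \<sqsubset> b1"
    using Cons.prems bs by (auto simp: zigzag_def)
  have zz: "zigzag (b1 # bs') ss"
    unfolding zigzag_def
  proof (intro conjI allI impI)
    fix t assume "t < length ss"
    with Cons.prems[unfolded zigzag_def bs]
    show "\<not> (b1 # bs') ! t \<sqsubset> ss ! t" "\<not> ss ! t \<sqsubset> (b1 # bs') ! t"
      "\<not> (b1 # bs') ! Suc t \<sqsubset> ss ! t" "\<not> ss ! t \<sqsubset> (b1 # bs') ! Suc t"
      by (auto dest!: spec[of _ "Suc t"])
  qed (use Cons.prems[unfolded zigzag_def bs] in auto)
  have ch: "chain (b0 # b1 # bs')" "chain (s0 # ss)"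
    using Cons.prems bs by (auto simp: zigzag_def)
  \<comment> \<open>\<open>s1\<close> is unrelated to \<open>b1\<close> and \<open>b2\<close>, so it
    is comparable with \<open>b0\<close>.\<close>
  have b0: "b0 \<sqsubset> s" if s: "s \<in> set ss" for s
  proof -
    obtain s1 ss' where ss: "ss = s1 # ss'" using s by (cases ss) auto
    obtain b2 bs'' where bs': "bs' = b2 # bs''"
      using zz ss by (cases bs') (auto simp: zigzag_def)
    have i: "\<not> b1 \<sqsubset> s1" "\<not> s1 \<sqsubset> b1" "\<not> b2 \<sqsubset> s1" "\<not> s1 \<sqsubset> b2"
      using zz ss bs' by (auto simp: zigzag_def)
    have "b0 \<sqsubset> b1" "b1 \<sqsubset> b2" using ch bs' by auto
    then have "b0 \<sqsubset> s1" using three_one[of b0 b1 b2 s1] i lt_trans by blast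
    then show ?thesis using s ss ch lt_trans[of b0 s1 s] by auto
  qed
  \<comment> \<open>\<open>s0\<close> is unrelated to \<open>b0\<close> and \<open>b1\<close>, so it
    is comparable with every later letter of the chain.\<close>
  have s0: "s0 \<sqsubset> b" if "b \<in> set bs'" for b
  proof -
    have "b0 \<sqsubset> b1" "b1 \<sqsubset> b" using ch that by auto
    then show ?thesis using three_one[of b0 b1 b s0] inc lt_trans by blast
  qed
  have "tab lt (b1 # bs') ss" using zz by (auto simp: zigzag_def tab_iff_nth)
  then have "rev (b1 # bs') @ rev [b0] @ rev ss \<approx> rev (b1 # bs') @ rev ss @ rev [b0]"
    using ch b0 by (intro pass_below) auto
  from pknuth_context[OF this, of "[]" "[s0]"]
  have "rev bs @ rev (s0 # ss) \<approx> rev (b1 # bs') @ rev ss @ [b0, s0]" using bs by simp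
  also have "\<dots> \<approx> rev ss @ rev bs' @ [b1, b0, s0]"
    using pknuth_context[OF Cons.IH[OF zz], of "[]" "[b0, s0]"] by simp
  also have "\<dots> \<approx> rev ss @ rev bs' @ [s0, b1, b0]"
    using pknuth_rotate[of lt b0 s0 b1 "rev ss @ rev bs'" "[]"] inc ch by simp
  also have "\<dots> \<approx> rev ss @ [s0] @ rev bs' @ [b1, b0]"
  proof -
    have "rev bs' @ rev [s0] @ rev [b0, b1] \<approx> rev [s0] @ rev bs' @ rev [b0, b1]"
      using ch inc s0 by (intro pass_above) auto
    from pknuth_context[OF this, of "rev ss" "[]"] show ?thesis by simp
  qed
  finally show ?case using bs by simp
qed


section \<open>Exchanging the lengths of two chains\<close>

text \<open>Read \<open>x\<close> as an opening and \<open>y\<close> as a closing bracket for every odd component of the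
  incomparability graph of two chains. In an odd split \<open>cy\<close>, \<open>cx\<close> is the component of the last
  unmatched closing bracket, and \<open>Suc d\<close> is the number of unmatched closing brackets.\<close>

definition odd_split :: "nat \<Rightarrow> 'a list \<Rightarrow> 'a list \<Rightarrow> 'a list \<Rightarrow> 'a list \<Rightarrow> 'a list \<Rightarrow> 'a list \<Rightarrow> bool" where
  "odd_split d lx cx rx ly cy ry \<longleftrightarrow>
     length ly = length lx + d \<and> zigzag cy cx \<and> tab lt rx ry \<and>
     tab (\<lambda>a b. b \<sqsubset> a) (rev ly) (rev lx) \<and>
     chain lx \<and> chain ly \<and> chain rx \<and> chain ry \<and>
     (\<forall>a\<in>set lx \<union> set ly. \<forall>b\<in>set cx \<union> set cy. a \<sqsubset> b) \<and>
     (\<forall>a\<in>set lx \<union> set ly \<union> set cx \<union> set cy. \<forall>b\<in>set rx \<union> set ry. a \<sqsubset> b)"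

lemma odd_split_chains:
  assumes "odd_split d lx cx rx ly cy ry"
  shows "chain (lx @ cx @ rx)" "chain (lx @ cy @ rx)" "chain (ly @ cx @ ry)" "chain (ly @ cy @ ry)"
  using assms by (auto simp: odd_split_def zigzag_def sorted_wrt_append)

text \<open>Passing brings both words to the form
  \<open>rev rx @ rev ry @ M @ rev lx @ rev ly\<close>, where \<open>M\<close> consists of
  \<open>rev cx\<close> and \<open>rev cy\<close> in one order or the other; these two
  commute.\<close>

lemma odd_split_pknuth:
  assumes "odd_split d lx cx rx ly cy ry"
  shows "rev (lx @ cx @ rx) @ rev (ly @ cy @ ry) \<approx> rev (lx @ cy @ rx) @ rev (ly @ cx @ ry)"
proof -
  note * = assms[unfolded odd_split_def]
  have below: "rev rx @ rev (lx @ c) @ rev ry \<approx> rev rx @ rev ry @ rev (lx @ c)"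
    if "c = cx \<or> c = cy" for c
    using * odd_split_chains[OF assms] that by (intro pass_below) auto
  have above: "rev c @ rev lx @ rev ly \<approx> rev lx @ rev c @ rev ly" if "c = cx \<or> c = cy" for c
    using * odd_split_chains[OF assms] that
    by (intro pass_above) (auto simp: sorted_wrt_append)
  have "rev (lx @ cx @ rx) @ rev (ly @ cy @ ry)
      \<approx> rev rx @ rev ry @ rev cx @ rev lx @ rev cy @ rev ly"
    using pknuth_context[OF below[of cx], of "[]" "rev cy @ rev ly"] by simp
  also have "\<dots> \<approx> rev rx @ rev ry @ rev cx @ rev cy @ rev lx @ rev ly"
    using pknuth_context[OF pknuth_sym[OF above[of cy]], of "rev rx @ rev ry @ rev cx" "[]"] by simp
  also have "\<dots> \<approx> rev rx @ rev ry @ rev cy @ rev cx @ rev lx @ rev ly"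
    using pknuth_context[OF pknuth_sym[OF zigzag_commute[of cy cx]],
        of "rev rx @ rev ry" "rev lx @ rev ly"] * by simp
  also have "\<dots> \<approx> rev rx @ rev ry @ rev cy @ rev lx @ rev cx @ rev ly"
    using pknuth_context[OF above[of cx], of "rev rx @ rev ry @ rev cy" "[]"] by simp
  also have "\<dots> \<approx> rev (lx @ cy @ rx) @ rev (ly @ cx @ ry)"
    using pknuth_context[OF pknuth_sym[OF below[of cy]], of "[]" "rev cx @ rev ly"] by simp
  finally show ?thesis .
qed

section \<open>Locating the component to be moved\<close>

lemma chain_cross:
  assumes "chain A" "chain B" "A \<noteq> [] \<Longrightarrow> B \<noteq> [] \<Longrightarrow> last A \<sqsubset> hd B" "a \<in> set A" "b \<in> set B"
  shows "a \<sqsubset> b"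
proof -
  obtain A' l where A: "A = A' @ [l]" using assms(4) by (cases A rule: rev_cases) auto
  obtain h B' where B: "B = h # B'" using assms(5) by (cases B) auto
  have "a = l \<or> a \<sqsubset> l" "b = h \<or> h \<sqsubset> b" "l \<sqsubset> h"
    using assms A B by (auto simp: sorted_wrt_append)
  then show ?thesis using lt_trans by blast
qed

text \<open>Compare \<open>xs ! i\<close> with \<open>ys ! (i + d)\<close>. The first failure
  \<open>j\<close> ends the component. Downwards from there successive letters remain unrelated as
  far as the last position \<open>m\<close> at which \<open>xs ! (m - 1)\<close> lies below
  \<open>ys ! (m + d)\<close>; there the component starts.\<close>

lemma odd_split_exists:
  assumes ch: "chain xs" "chain ys"
    and tab: "tab lt xs (drop (Suc d) ys)" and ntab: "\<not> tab lt xs (drop d ys)"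
  obtains lx cx rx ly cy ry where "odd_split d lx cx rx ly cy ry"
    "xs = lx @ cx @ rx" "ys = ly @ cy @ ry"
proof -
  \<comment> \<open>A letter of \<open>ys\<close> with no partner because \<open>xs\<close> is too
    short also counts as a failure.\<close>
  define fail where "fail j \<longleftrightarrow> j + d < length ys \<and> (j < length xs \<longrightarrow> ys ! (j + d) \<sqsubset> xs ! j)" for j
  have "\<exists>j. fail j"
  proof (rule ccontr)
    assume "\<nexists>j. fail j"
    then have nf: "\<And>j. j + d < length ys \<Longrightarrow> j < length xs \<and> \<not> ys ! (j + d) \<sqsubset> xs ! j"
      by (auto simp: fail_def)
    have "length ys - d \<le> length xs"
      using nf[of "length xs"] by (cases "length xs + d < length ys") auto
    then have "tab lt xs (drop d ys)"
      using nf by (auto simp: tab_iff_nth add.commute less_diff_conv)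
    with ntab show False by simp
  qed
  define j where "j = (LEAST j. fail j)"
  have j: "j + d < length ys" "j < length xs \<Longrightarrow> ys ! (j + d) \<sqsubset> xs ! j"
    using LeastI_ex[OF \<open>\<exists>j. fail j\<close>] by (auto simp: j_def fail_def)
  have min: "i < length xs \<and> \<not> ys ! (i + d) \<sqsubset> xs ! i" if "i < j" for i
  proof -
    have "\<not> fail i" using not_less_Least[of i fail] that unfolding j_def by blast
    then show ?thesis using that j by (auto simp: fail_def)
  qed
  have tab': "\<not> ys ! Suc (i + d) \<sqsubset> xs ! i" "i < length xs" if "Suc (i + d) < length ys" for i
    using tab that by (auto simp: tab_iff_nth add.commute less_diff_conv)
  have j_le: "j \<le> length xs" using min[of "j - 1"] by (cases j) auto
  have xs_less: "xs ! a \<sqsubset> xs ! b" if "a < b" "b < length xs" for a b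
    using sorted_wrt_nth_less[OF ch(1)] that by blast
  have ys_less: "ys ! a \<sqsubset> ys ! b" if "a < b" "b < length ys" for a b
    using sorted_wrt_nth_less[OF ch(2)] that by blast
  \<comment> \<open>Position 0 always belongs to \<open>M\<close>; in that case the component starts
    at the bottom of \<open>xs\<close>.\<close>
  define M where "M = {m. m \<le> j \<and> (m = 0 \<or> xs ! (m - 1) \<sqsubset> ys ! (m + d))}"
  define m where "m = Max M"
  have "finite M" "0 \<in> M" by (auto simp: M_def)
  then have "m \<in> M" unfolding m_def by (intro Max_in) auto
  then have m: "m \<le> j" "0 < m \<Longrightarrow> xs ! (m - 1) \<sqsubset> ys ! (m + d)" by (auto simp: M_def)
  have m_max: "\<not> xs ! i \<sqsubset> ys ! Suc (i + d)" if "m \<le> i" "i < j" for i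
  proof -
    have "Suc i \<notin> M"
      using Max_ge[OF \<open>finite M\<close>, of "Suc i"] that unfolding m_def[symmetric] by auto
    then show ?thesis using that by (auto simp: M_def)
  qed
  \<comment> \<open>Minimality of \<open>j\<close> excludes the first relation, maximality of
    \<open>m\<close> the last; the other two would imply one of these by transitivity along
    \<open>ys\<close>.\<close>
  have inc: "\<not> ys ! (i + d) \<sqsubset> xs ! i \<and> \<not> xs ! i \<sqsubset> ys ! (i + d) \<and>
      \<not> ys ! Suc (i + d) \<sqsubset> xs ! i \<and> \<not> xs ! i \<sqsubset> ys ! Suc (i + d)" if "m \<le> i" "i < j" for i
  proof -
    have "ys ! (i + d) \<sqsubset> ys ! Suc (i + d)" using ys_less that j by simp
    then show ?thesis using m_max[OF that] min[OF that(2)] lt_trans by blast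
  qed

  define lx where "lx = take m xs"
  define cx where "cx = take (j - m) (drop m xs)"
  define rx where "rx = drop j xs"
  define ly where "ly = take (m + d) ys"
  define cy where "cy = take (Suc j - m) (drop (m + d) ys)"
  define ry where "ry = drop (Suc (j + d)) ys"
  have split: "xs = lx @ cx @ rx" "ys = ly @ cy @ ry"
  proof -
    have "drop m xs = cx @ rx"
      using append_take_drop_id[of "j - m" "drop m xs"] m by (simp add: cx_def rx_def)
    then show "xs = lx @ cx @ rx" by (metis lx_def append_take_drop_id)
    have "drop (m + d) ys = cy @ ry"
      using append_take_drop_id[of "Suc j - m" "drop (m + d) ys"] m
      by (simp add: cy_def ry_def)
    then show "ys = ly @ cy @ ry" by (metis ly_def append_take_drop_id)
  qed
  have len: "length lx = m" "length ly = m + d" "length cx = j - m" "length cy = Suc (j - m)"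
    using j j_le m by (auto simp: lx_def ly_def cx_def cy_def)
  have cx_nth: "cx ! t = xs ! (m + t)" if "t < j - m" for t
    using that j_le by (simp add: cx_def)
  have cy_nth: "cy ! t = ys ! (m + t + d)" if "t < Suc (j - m)" for t
    using that j m by (simp add: cy_def add_ac)
  have sub: "chain lx" "chain cx" "chain rx" "chain ly" "chain cy" "chain ry"
    "\<And>a b. a \<in> set lx \<Longrightarrow> b \<in> set cx \<Longrightarrow> a \<sqsubset> b" "\<And>a b. a \<in> set ly \<Longrightarrow> b \<in> set cy \<Longrightarrow> a \<sqsubset> b"
    "\<And>a b. a \<in> set lx \<Longrightarrow> b \<in> set rx \<Longrightarrow> a \<sqsubset> b" "\<And>a b. a \<in> set ly \<Longrightarrow> b \<in> set ry \<Longrightarrow> a \<sqsubset> b"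
    "\<And>a b. a \<in> set cx \<Longrightarrow> b \<in> set rx \<Longrightarrow> a \<sqsubset> b" "\<And>a b. a \<in> set cy \<Longrightarrow> b \<in> set ry \<Longrightarrow> a \<sqsubset> b"
    using ch[unfolded split] by (auto simp: sorted_wrt_append)
  have zz: "zigzag cy cx"
    unfolding zigzag_def
  proof (intro conjI allI impI)
    fix t assume "t < length cx"
    then show "\<not> cy ! t \<sqsubset> cx ! t" "\<not> cx ! t \<sqsubset> cy ! t"
      "\<not> cy ! Suc t \<sqsubset> cx ! t" "\<not> cx ! t \<sqsubset> cy ! Suc t"
      using inc[of "m + t"] by (auto simp: len cx_nth cy_nth)
  qed (use sub len in auto)
  have upper: "tab lt rx ry"
    unfolding tab_iff_nth
  proof (intro conjI allI impI)
    fix t assume "t < length ry"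
    then show "\<not> ry ! t \<sqsubset> rx ! t"
      using tab'[of "j + t"] j_le by (simp add: rx_def ry_def add_ac)
  next
    show "length ry \<le> length rx"
      using tab[unfolded tab_iff_nth, THEN conjunct1] by (simp add: rx_def ry_def)
  qed
  have lower: "tab (\<lambda>a b. b \<sqsubset> a) (rev ly) (rev lx)"
    unfolding tab_iff_nth
  proof (intro conjI allI impI)
    fix t assume t: "t < length (rev lx)"
    then have *: "\<not> ys ! (m - Suc t + d) \<sqsubset> xs ! (m - Suc t)"
      using min[of "m - Suc t"] m len by auto
    have "rev lx ! t = xs ! (m - Suc t)" "rev ly ! t = ys ! (m - Suc t + d)"
      using t len by (auto simp: rev_nth lx_def ly_def)
    with * show "\<not> rev ly ! t \<sqsubset> rev lx ! t" by simp
  qed (use len in auto)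
  have lx_cy: "a \<sqsubset> b" if "a \<in> set lx" "b \<in> set cy" for a b
  proof (rule chain_cross[OF sub(1,5) _ that])
    assume "lx \<noteq> []" "cy \<noteq> []"
    then have "0 < m" "last lx = xs ! (m - 1)" "hd cy = ys ! (m + d)"
      using len cy_nth[of 0] by (auto simp: last_conv_nth hd_conv_nth lx_def)
    with m show "last lx \<sqsubset> hd cy" by simp
  qed
  \<comment> \<open>\<open>xs ! m\<close> is unrelated to two successive letters of
    \<open>ys\<close>, so (3+1)-freeness makes it comparable with the letter before them.\<close>
  have ly_cx: "a \<sqsubset> b" if "a \<in> set ly" "b \<in> set cx" for a b
  proof (rule chain_cross[OF sub(4,2) _ that])
    assume "ly \<noteq> []" "cx \<noteq> []"
    moreover from this have mj: "m < j" "0 < m + d" using len by (metis length_greater_0_conv zero_less_diff)+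
    ultimately have *: "m < j" "0 < m + d" "last ly = ys ! (m + d - 1)" "hd cx = xs ! m"
      using len cx_nth[of 0] j by (auto simp: last_conv_nth hd_conv_nth ly_def)
    then have "ys ! (m + d - 1) \<sqsubset> ys ! (m + d)" "ys ! (m + d) \<sqsubset> ys ! Suc (m + d)"
      using ys_less j by auto
    then have "ys ! (m + d - 1) \<sqsubset> xs ! m"
      using three_one[of "ys ! (m + d - 1)" "ys ! (m + d)" "ys ! Suc (m + d)" "xs ! m"]
        inc[OF order_refl *(1)] lt_trans by blast
    with * show "last ly \<sqsubset> hd cx" by simp
  qed
  \<comment> \<open>\<open>xs ! (j - 1)\<close> is comparable with one of three successive letters
    of \<open>ys\<close>. It cannot lie above any of them, since the smallest is not below it; so it
    lies below the largest.\<close>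
  have x_ry: "a \<sqsubset> b" if "a \<in> set (lx @ cx)" "b \<in> set ry" for a b
  proof (rule chain_cross[OF _ sub(6) _ that])
    show "chain (lx @ cx)" using sub by (auto simp: sorted_wrt_append)
    assume ne: "lx @ cx \<noteq> []" "ry \<noteq> []"
    have "length (lx @ cx) = j" using len m by simp
    then have "0 < j" using ne by (metis length_greater_0_conv)
    then have *: "0 < j" "Suc (j + d) < length ys" "hd ry = ys ! Suc (j + d)"
      using ne by (auto simp: hd_conv_nth ry_def)
    have "lx @ cx = take j xs"
      using split(1) \<open>length (lx @ cx) = j\<close> by (metis append.assoc append_eq_conv_conj)
    then have last: "last (lx @ cx) = xs ! (j - 1)"
      using ne j_le * by (simp add: last_conv_nth min_def)
    have "ys ! (j + d - 1) \<sqsubset> ys ! (j + d)" "ys ! (j + d) \<sqsubset> ys ! Suc (j + d)"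
      using ys_less * by auto
    moreover have "\<not> ys ! (j + d - 1) \<sqsubset> xs ! (j - 1)"
      using min[of "j - 1"] * by (cases j) auto
    ultimately have "xs ! (j - 1) \<sqsubset> ys ! Suc (j + d)"
      using three_one[of "ys ! (j + d - 1)" "ys ! (j + d)" "ys ! Suc (j + d)" "xs ! (j - 1)"]
        lt_trans by blast
    with last * show "last (lx @ cx) \<sqsubset> hd ry" by simp
  qed
  have y_rx: "a \<sqsubset> b" if "a \<in> set (ly @ cy)" "b \<in> set rx" for a b
  proof (rule chain_cross[OF _ sub(3) _ that])
    show "chain (ly @ cy)" using sub by (auto simp: sorted_wrt_append)
    assume ne: "ly @ cy \<noteq> []" "rx \<noteq> []"
    then have *: "j < length xs" "hd rx = xs ! j" by (auto simp: hd_conv_nth rx_def)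
    have "length (ly @ cy) = Suc (j + d)" using len m by simp
    then have "ly @ cy = take (Suc (j + d)) ys"
      using split(2) by (metis append.assoc append_eq_conv_conj)
    then have "last (ly @ cy) = ys ! (j + d)"
      using j by (simp add: take_Suc_conv_app_nth)
    with j * show "last (ly @ cy) \<sqsubset> hd rx" by simp
  qed
  have "odd_split d lx cx rx ly cy ry"
    unfolding odd_split_def using len zz upper lower sub lx_cy ly_cx x_ry y_rx by auto
  with split show thesis using that by blast
qed

text \<open>In the flipped pair the first letter of \<open>cy\<close> is the extra one: without it
  the upper parts satisfy the row condition. This rules out a second split that starts higher
  up.\<close>

lemma odd_split_tail:
  assumes "odd_split d lx cx rx ly cy ry"
  shows "tab lt (tl cy @ rx) (cx @ ry)"
  using assms
  by (intro tab_append) (auto simp: odd_split_def zigzag_def tab_iff_nth nth_tl)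

text \<open>The crystal statistic epsilon, the number of unmatched closing brackets, expressed
  without components. The minimum exists because \<open>d = length ys\<close> always works.\<close>

definition eps :: "'a list \<Rightarrow> 'a list \<Rightarrow> nat" where
  "eps xs ys = (LEAST d. tab lt xs (drop d ys))"

lemma eps_SucD:
  assumes "eps xs ys = Suc d"
  shows "tab lt xs (drop (Suc d) ys)" "\<not> tab lt xs (drop d ys)"
proof -
  have "tab lt xs (drop (length ys) ys)" by simp
  then show "tab lt xs (drop (Suc d) ys)" using assms unfolding eps_def by (metis LeastI)
  show "\<not> tab lt xs (drop d ys)"
    using not_less_Least[of d "\<lambda>d. tab lt xs (drop d ys)"] assms by (simp add: eps_def)
qed

text \<open>A pair whose second chain is longer by \<open>n\<close> has at least \<open>n\<close>
  unmatched closing brackets, so \<open>n\<close> moves are available and the subtraction in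
  \<open>embeds_swap_le\<close> does not truncate.\<close>

lemma eps_ge: "length ys \<le> length xs + eps xs ys"
proof -
  have "tab lt xs (drop (length ys) ys)" by simp
  then have "tab lt xs (drop (eps xs ys) ys)" unfolding eps_def by (rule LeastI)
  then have "length (drop (eps xs ys) ys) \<le> length xs" unfolding tab_iff_nth by blast
  then show ?thesis by simp
qed

text \<open>After dropping \<open>d\<close> letters the pieces align: \<open>lx\<close> with the
  rest of \<open>ly\<close>, \<open>butlast cy\<close> with \<open>cx\<close>, and
  \<open>last cy # rx\<close> with \<open>ry\<close>. With fewer dropped, a letter of
  \<open>ly\<close> faces the first letter of \<open>cy\<close>, which lies above it.\<close>

lemma eps_flip:
  assumes "odd_split d lx cx rx ly cy ry"
  shows "eps (lx @ cy @ rx) (ly @ cx @ ry) = d"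
  unfolding eps_def
proof (rule Least_equality)
  note * = assms[unfolded odd_split_def zigzag_def]
  obtain c cy' where cy: "cy = c # cy'" using * by (cases cy) auto
  have low: "\<not> ly ! (i + d) \<sqsubset> lx ! i" if "i < length lx" for i
  proof -
    have "\<not> rev ly ! (length lx - Suc i) \<sqsubset> rev lx ! (length lx - Suc i)"
      using * that by (auto simp: tab_iff_nth)
    then show ?thesis using * that by (simp add: rev_nth add.commute)
  qed
  have "tab lt lx (drop d ly)"
    using low * by (auto simp: tab_iff_nth add.commute)
  moreover have "tab lt (cy @ rx) (cx @ ry)"
  proof -
    have last: "last cy \<in> set cy" using cy by simp
    have "tab lt (butlast cy) cx" using * by (auto simp: tab_iff_nth nth_butlast)
    moreover have "tab lt (last cy # rx) ry"
      using * last by (intro tab_Cons_left) auto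
    ultimately have "tab lt (butlast cy @ last cy # rx) (cx @ ry)"
      using * by (intro tab_append) auto
    moreover have "cy = butlast cy @ [last cy]" using cy by simp
    ultimately show ?thesis by (metis append.assoc append_Cons append_Nil)
  qed
  ultimately have "tab lt (lx @ cy @ rx) (drop d ly @ cx @ ry)"
    using tab_append[of lx "drop d ly" lt "cy @ rx" "cx @ ry"] * by simp
  then show "tab lt (lx @ cy @ rx) (drop d (ly @ cx @ ry))" using * by simp
next
  fix d' assume tab: "tab lt (lx @ cy @ rx) (drop d' (ly @ cx @ ry))"
  note * = assms[unfolded odd_split_def zigzag_def]
  obtain c cy' where cy: "cy = c # cy'" using * by (cases cy) auto
  show "d \<le> d'"
  proof (rule ccontr)
    assume "\<not> d \<le> d'"
    then have d': "d' < d" by simp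
    then have "length lx < length (drop d' (ly @ cx @ ry))" using * by simp
    then have "\<not> drop d' (ly @ cx @ ry) ! length lx \<sqsubset> (lx @ cy @ rx) ! length lx"
      using tab unfolding tab_iff_nth by blast
    then have "\<not> (ly @ cx @ ry) ! (d' + length lx) \<sqsubset> (lx @ cy @ rx) ! length lx"
      using nth_drop[of d' "ly @ cx @ ry" "length lx"] d' * by auto
    then have "\<not> ly ! (d' + length lx) \<sqsubset> c" using d' * cy by (simp add: nth_append)
    moreover have "ly ! (d' + length lx) \<in> set ly" using d' * by simp
    ultimately show False using * cy by auto
  qed
qed

text \<open>If the second split started higher, the last letter of \<open>ly'\<close> would face the
  first letter of \<open>cy'\<close> in the comparison of \<open>odd_split_tail\<close>, though the
  second split puts it below that letter.\<close>

lemma odd_split_left_unique: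
  assumes s: "odd_split d lx cx rx ly cy ry" and s': "odd_split d lx' cx' rx' ly' cy' ry'"
    and eq: "lx @ cy @ rx = lx' @ cy' @ rx'" "ly @ cx @ ry = ly' @ cx' @ ry'"
  shows "length lx' \<le> length lx"
proof (rule ccontr)
  assume "\<not> length lx' \<le> length lx"
  then have lt: "length lx < length lx'" by simp
  note * = s[unfolded odd_split_def zigzag_def]
  note ** = s'[unfolded odd_split_def zigzag_def]
  obtain c cs where cy: "cy = c # cs" using * by (cases cy) auto
  obtain c' cs' where cy': "cy' = c' # cs'" using ** by (cases cy') auto
  define t where "t = length lx' - Suc (length lx)"
  define u where "u = length ly' - 1"
  have u: "u < length ly'" "u = length ly + t" using lt * ** by (auto simp: u_def t_def)
  have len: "length lx' = Suc (length lx + t)" using lt by (simp add: t_def)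
  have "length (ly @ cx @ ry) = length (ly' @ cx' @ ry')" using eq by simp
  then have "t < length (cx @ ry)" using u by simp
  then have "\<not> (cx @ ry) ! t \<sqsubset> (cs @ rx) ! t"
    using odd_split_tail[OF s] cy by (auto simp: tab_iff_nth)
  moreover have "(cx @ ry) ! t = (ly @ cx @ ry) ! u" using u by (simp add: nth_append)
  then have "(cx @ ry) ! t = ly' ! u" using u eq by (simp add: nth_append)
  moreover have "(cs @ rx) ! t = (lx @ cy @ rx) ! length lx'"
    using len cy by (simp add: nth_append)
  then have "(cs @ rx) ! t = c'" using eq cy' by (simp add: nth_append)
  moreover have "ly' ! u \<sqsubset> c'" using ** u cy' by auto
  ultimately show False by simp
qed

text \<open>If the second component were longer, \<open>last cy\<close> and the first letter of
  \<open>ry\<close> would be unrelated in the second split, but the first split puts the former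
  below the latter.\<close>

lemma odd_split_middle_unique:
  assumes s: "odd_split d lx cx rx ly cy ry" and s': "odd_split d lx cx' rx' ly cy' ry'"
    and eq: "cy @ rx = cy' @ rx'" "cx @ ry = cx' @ ry'"
  shows "length cx' \<le> length cx"
proof (rule ccontr)
  assume "\<not> length cx' \<le> length cx"
  then have lt: "length cx < length cx'" by simp
  note * = s[unfolded odd_split_def zigzag_def]
  note ** = s'[unfolded odd_split_def zigzag_def]
  define t where "t = length cx"
  have "cy ! t = (cy @ rx) ! t" using * by (simp add: t_def nth_append)
  then have cy: "cy ! t = cy' ! t" using eq lt ** by (simp add: t_def nth_append)
  have "length (cx @ ry) = length (cx' @ ry')" using eq by simp
  then have ry: "ry \<noteq> []" using lt by auto
  have "ry ! 0 = (cx @ ry) ! t" by (simp add: t_def nth_append)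
  then have "ry ! 0 = cx' ! t" using eq lt by (simp add: t_def nth_append)
  moreover have "cy ! t \<sqsubset> ry ! 0" using * ry by (auto simp: t_def)
  moreover have "\<not> cy' ! t \<sqsubset> cx' ! t" using ** lt by (simp add: t_def)
  ultimately show False using cy by simp
qed

lemma odd_split_unique:
  assumes s: "odd_split d lx cx rx ly cy ry" and s': "odd_split d lx' cx' rx' ly' cy' ry'"
    and eq: "lx @ cy @ rx = lx' @ cy' @ rx'" "ly @ cx @ ry = ly' @ cx' @ ry'"
  shows "lx @ cx @ rx = lx' @ cx' @ rx' \<and> ly @ cy @ ry = ly' @ cy' @ ry'"
proof -
  note * = s[unfolded odd_split_def zigzag_def]
  note ** = s'[unfolded odd_split_def zigzag_def]
  have l: "length lx = length lx'"
    using odd_split_left_unique[OF s s' eq] odd_split_left_unique[OF s' s eq[symmetric]] by simp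
  then have "length ly = length ly'" using * ** by simp
  with l eq have lxy: "lx = lx'" "ly = ly'" by auto
  with eq have eq': "cy @ rx = cy' @ rx'" "cx @ ry = cx' @ ry'" by auto
  have "length cx = length cx'"
    using odd_split_middle_unique[OF s s'[folded lxy] eq']
      odd_split_middle_unique[OF s'[folded lxy] s eq'[symmetric]] by simp
  moreover from this have "length cy = length cy'" using * ** by simp
  ultimately show ?thesis using eq' lxy by simp
qed

section \<open>Injections of chain pairs that preserve the P-Knuth class\<close>

definition chain_pairs :: "nat \<Rightarrow> nat \<Rightarrow> ('a list \<times> 'a list) set" where
  "chain_pairs p q = {(xs, ys). chain xs \<and> chain ys \<and> length xs = p \<and> length ys = q}"

definition eps_pairs :: "nat \<Rightarrow> nat \<Rightarrow> nat \<Rightarrow> ('a list \<times> 'a list) set" where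
  "eps_pairs p q d = {(xs, ys) \<in> chain_pairs p q. eps xs ys = d}"

definition embeds :: "('a list \<times> 'a list) set \<Rightarrow> ('a list \<times> 'a list) set \<Rightarrow> bool" where
  "embeds S S' \<longleftrightarrow>
     (\<exists>E. inj_on E S \<and> (\<forall>z\<in>S. E z \<in> S' \<and> pair_word z \<approx> pair_word (E z)))"

lemma embeds_refl: "embeds S S"
  unfolding embeds_def by (rule exI[of _ id]) (auto intro: pknuth_refl)

lemma embeds_trans:
  assumes "embeds S S'" "embeds S' S''"
  shows "embeds S S''"
proof -
  obtain E E' where E: "inj_on E S" "\<And>z. z \<in> S \<Longrightarrow> E z \<in> S' \<and> pair_word z \<approx> pair_word (E z)"
    and E': "inj_on E' S'" "\<And>z. z \<in> S' \<Longrightarrow> E' z \<in> S'' \<and> pair_word z \<approx> pair_word (E' z)"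
    using assms unfolding embeds_def by metis
  have "inj_on (E' \<circ> E) S"
  proof (rule comp_inj_on[OF E(1) inj_on_subset[OF E'(1)]])
    show "E ` S \<subseteq> S'" using E(2) by blast
  qed
  moreover have "(E' \<circ> E) z \<in> S'' \<and> pair_word z \<approx> pair_word ((E' \<circ> E) z)" if "z \<in> S" for z
  proof -
    have 1: "E z \<in> S'" "pair_word z \<approx> pair_word (E z)" using E(2)[OF that] by auto
    have 2: "E' (E z) \<in> S''" "pair_word (E z) \<approx> pair_word (E' (E z))"
      using E'(2)[OF 1(1)] by auto
    show ?thesis using 2(1) pknuth_trans[OF 1(2) 2(2)] by simp
  qed
  ultimately show ?thesis unfolding embeds_def by blast
qed

text \<open>One crystal operator, lowering \<open>eps\<close> by one.\<close>

lemma embeds_step: "embeds (eps_pairs p (Suc q) (Suc d)) (eps_pairs (Suc p) q d)"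
proof -
  define flips where "flips z z' \<longleftrightarrow> (\<exists>lx cx rx ly cy ry. odd_split d lx cx rx ly cy ry \<and>
    z = (lx @ cx @ rx, ly @ cy @ ry) \<and> z' = (lx @ cy @ rx, ly @ cx @ ry))" for z z'
  have ex: "\<exists>z'. flips z z'" if z: "z \<in> eps_pairs p (Suc q) (Suc d)" for z
  proof -
    obtain xs ys where xy: "z = (xs, ys)" "chain xs" "chain ys" "eps xs ys = Suc d"
      using z by (auto simp: eps_pairs_def chain_pairs_def)
    from odd_split_exists[OF xy(2,3) eps_SucD[OF xy(4)]] show ?thesis
      unfolding flips_def xy(1) by metis
  qed
  \<comment> \<open>Any choice is injective, because by \<open>odd_split_unique\<close> a flipped
    pair comes from only one pair.\<close>
  define E where "E z = (SOME z'. flips z z')" for z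
  have E: "flips z (E z)" if "z \<in> eps_pairs p (Suc q) (Suc d)" for z
    using ex[OF that] unfolding E_def by (rule someI_ex)
  have uniq: "z1 = z2" if flips: "flips z1 z'" "flips z2 z'" for z1 z2 z'
  proof -
    obtain lx cx rx ly cy ry where 1: "odd_split d lx cx rx ly cy ry"
      "z1 = (lx @ cx @ rx, ly @ cy @ ry)" "z' = (lx @ cy @ rx, ly @ cx @ ry)"
      using flips(1) unfolding flips_def by blast
    obtain lx' cx' rx' ly' cy' ry' where 2: "odd_split d lx' cx' rx' ly' cy' ry'"
      "z2 = (lx' @ cx' @ rx', ly' @ cy' @ ry')" "z' = (lx' @ cy' @ rx', ly' @ cx' @ ry')"
      using flips(2) unfolding flips_def by blast
    show ?thesis using odd_split_unique[OF 1(1) 2(1)] 1 2 by simp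
  qed
  have "E z \<in> eps_pairs (Suc p) q d \<and> pair_word z \<approx> pair_word (E z)"
    if z: "z \<in> eps_pairs p (Suc q) (Suc d)" for z
  proof -
    obtain lx cx rx ly cy ry where s: "odd_split d lx cx rx ly cy ry"
      "z = (lx @ cx @ rx, ly @ cy @ ry)" "E z = (lx @ cy @ rx, ly @ cx @ ry)"
      using E[OF z] unfolding flips_def by blast
    have "length cy = Suc (length cx)" using s(1) by (simp add: odd_split_def zigzag_def)
    then have "E z \<in> eps_pairs (Suc p) q d"
      using z[unfolded s(2)] odd_split_chains[OF s(1)] eps_flip[OF s(1)]
      unfolding s(3) by (auto simp: eps_pairs_def chain_pairs_def)
    moreover have "pair_word z \<approx> pair_word (E z)"
    proof -
      have "pair_word z = rev (lx @ cx @ rx) @ rev (ly @ cy @ ry)" unfolding s(2) pair_word_def by simp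
      moreover have "pair_word (E z) = rev (lx @ cy @ rx) @ rev (ly @ cx @ ry)"
        unfolding s(3) pair_word_def by simp
      ultimately show ?thesis using odd_split_pknuth[OF s(1)] by metis
    qed
    ultimately show ?thesis by blast
  qed
  moreover have "inj_on E (eps_pairs p (Suc q) (Suc d))"
    by (rule inj_onI) (metis E uniq)
  ultimately show ?thesis unfolding embeds_def by blast
qed

lemma embeds_steps: "embeds (eps_pairs p (q + n) (d + n)) (eps_pairs (p + n) q d)"
proof (induction n arbitrary: p)
  case (Suc n)
  show ?case using embeds_trans[OF embeds_step Suc.IH[of "Suc p"]] by simp
qed (simp add: embeds_refl)

text \<open>The reflection of a crystal string: \<open>n = q - p\<close> operators are applied. The
  maps for the different values of \<open>eps\<close> can be glued, since \<open>eps\<close> of the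
  image is \<open>d\<close> and thus keeps their images disjoint.\<close>

lemma embeds_swap_le:
  assumes "p \<le> q"
  shows "embeds (chain_pairs p q) (chain_pairs q p)"
proof -
  define n where "n = q - p"
  have q: "q = p + n" using assms by (simp add: n_def)
  have "embeds (eps_pairs p q (d + n)) (eps_pairs q p d)" for d
    using embeds_steps[of p p n d] q by simp
  then obtain E where inj: "\<And>d. inj_on (E d) (eps_pairs p q (d + n))"
    and E: "\<And>d z. z \<in> eps_pairs p q (d + n) \<Longrightarrow>
      E d z \<in> eps_pairs q p d \<and> pair_word z \<approx> pair_word (E d z)"
    unfolding embeds_def by metis
  define e where "e z = eps (fst z) (snd z) - n" for z
  have e: "z \<in> eps_pairs p q (e z + n)" if "z \<in> chain_pairs p q" for z
    using that eps_ge[of "snd z" "fst z"] q by (auto simp: e_def eps_pairs_def chain_pairs_def)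
  have "inj_on (\<lambda>z. E (e z) z) (chain_pairs p q)"
  proof (rule inj_onI)
    fix z z' assume z: "z \<in> chain_pairs p q" "z' \<in> chain_pairs p q" and eq: "E (e z) z = E (e z') z'"
    have "E (e z) z \<in> eps_pairs q p (e z)" "E (e z') z' \<in> eps_pairs q p (e z')"
      using E e z by blast+
    with eq have "e z = e z'" by (auto simp: eps_pairs_def)
    then show "z = z'" using inj_onD[OF inj eq[folded \<open>e z = e z'\<close>]] e z by metis
  qed
  moreover have "E (e z) z \<in> chain_pairs q p \<and> pair_word z \<approx> pair_word (E (e z) z)"
    if "z \<in> chain_pairs p q" for z
    using E[OF e[OF that]] by (auto simp: eps_pairs_def)
  ultimately show ?thesis unfolding embeds_def by blast
qed

text \<open>The remaining case follows by duality: \<open>D\<close> reverses both chains and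
  exchanges them, which reverses \<open>pair_word\<close>.\<close>

lemma embeds_swap: "embeds (chain_pairs p q) (chain_pairs q p)"
proof (cases "p \<le> q")
  case False
  let ?gt = "\<lambda>a b. b \<sqsubset> a"
  interpret d: three_one_free_order ?gt
    by (rule three_one_free_order_dual) unfold_locales
  define D :: "'a list \<times> 'a list \<Rightarrow> 'a list \<times> 'a list" where "D z = (rev (snd z), rev (fst z))" for z
  have DD: "D (D z) = z" for z by (simp add: D_def)
  then have injD: "inj_on D S" for S by (metis inj_onI)
  have D1: "D z \<in> d.chain_pairs b a" if "z \<in> chain_pairs a b" for z a b
    using that by (auto simp: D_def d.chain_pairs_def chain_pairs_def sorted_wrt_rev)
  have D2: "D z \<in> chain_pairs b a" if "z \<in> d.chain_pairs a b" for z a b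
    using that by (auto simp: D_def d.chain_pairs_def chain_pairs_def sorted_wrt_rev)
  obtain E where E: "inj_on E (d.chain_pairs q p)"
    "\<And>z. z \<in> d.chain_pairs q p \<Longrightarrow>
       E z \<in> d.chain_pairs p q \<and> pknuth ?gt (pair_word z) (pair_word (E z))"
    using d.embeds_swap_le[of q p] False unfolding d.embeds_def by auto
  have "inj_on (D \<circ> E \<circ> D) (chain_pairs p q)"
  proof -
    have "inj_on (E \<circ> D) (chain_pairs p q)"
      using D1 by (intro comp_inj_on[OF injD inj_on_subset[OF E(1)]]) auto
    from comp_inj_on[OF this injD] show ?thesis by (simp add: comp_assoc)
  qed
  moreover have "(D \<circ> E \<circ> D) z \<in> chain_pairs q p \<and> pair_word z \<approx> pair_word ((D \<circ> E \<circ> D) z)"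
    if "z \<in> chain_pairs p q" for z
  proof -
    note * = E(2)[OF D1[OF that]]
    have "rev (pair_word (D z)) \<approx> rev (pair_word (E (D z)))"
      by (rule pknuth_rev[OF *[THEN conjunct2]])
    then have "pair_word z \<approx> pair_word (D (E (D z)))"
      by (simp add: D_def pair_word_def)
    with D2[OF *[THEN conjunct1]] show ?thesis by simp
  qed
  ultimately show ?thesis unfolding embeds_def by blast
qed (rule embeds_swap_le)

text \<open>A single map serves all sizes, since it reads the lengths off its argument.\<close>

lemma chain_pair_swap:
  obtains g where "\<And>p q. inj_on g (chain_pairs p q)"
    "\<And>p q z. z \<in> chain_pairs p q \<Longrightarrow> g z \<in> chain_pairs q p \<and> pair_word z \<approx> pair_word (g z)"
proof -
  obtain E where E: "\<And>p q. inj_on (E p q) (chain_pairs p q)"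
    "\<And>p q z. z \<in> chain_pairs p q \<Longrightarrow> E p q z \<in> chain_pairs q p \<and> pair_word z \<approx> pair_word (E p q z)"
    using embeds_swap unfolding embeds_def by metis
  define g where "g z = E (length (fst z)) (length (snd z)) z" for z
  have g: "g z = E p q z" if "z \<in> chain_pairs p q" for p q z
    using that by (auto simp: g_def chain_pairs_def)
  show ?thesis
  proof (rule that)
    show "inj_on g (chain_pairs p q)" for p q
      using E(1)[of p q] g by (subst inj_on_cong[of _ _ "E p q"]) auto
  qed (use E(2) g in auto)
qed

end

section \<open>Congruence modulo the P-plactic ideal\<close>

lemma ncmul_superset:
  assumes "finite A" "Poly_Mapping.keys p \<subseteq> A" "finite B" "Poly_Mapping.keys q \<subseteq> B"
  shows "ncmul p q = (\<Sum>v\<in>A. \<Sum>w\<in>B.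
    Poly_Mapping.single (v @ w) (Poly_Mapping.lookup p v * Poly_Mapping.lookup q w))"
proof -
  have "(\<Sum>w\<in>Poly_Mapping.keys q. Poly_Mapping.single (v @ w) (Poly_Mapping.lookup p v * Poly_Mapping.lookup q w))
      = (\<Sum>w\<in>B. Poly_Mapping.single (v @ w) (Poly_Mapping.lookup p v * Poly_Mapping.lookup q w))" for v
    using assms by (intro sum.mono_neutral_left) (auto simp: in_keys_iff)
  then show ?thesis
    unfolding ncmul_def using assms
    by (simp, intro sum.mono_neutral_left) (auto simp: in_keys_iff)
qed

lemma ncmul_add_left: "ncmul (p + p') q = ncmul p q + ncmul p' q"
proof -
  let ?A = "Poly_Mapping.keys p \<union> Poly_Mapping.keys p'"
  have "Poly_Mapping.keys (p + p') \<subseteq> ?A" by (rule Poly_Mapping.keys_add)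
  then show ?thesis
    using ncmul_superset[of ?A _ "Poly_Mapping.keys q" q]
    by (simp add: lookup_add distrib_right single_add sum.distrib)
qed

lemma ncmul_add_right: "ncmul p (q + q') = ncmul p q + ncmul p q'"
proof -
  let ?A = "Poly_Mapping.keys q \<union> Poly_Mapping.keys q'"
  have "Poly_Mapping.keys (q + q') \<subseteq> ?A" by (rule Poly_Mapping.keys_add)
  then show ?thesis
    using ncmul_superset[of "Poly_Mapping.keys p" p ?A]
    by (simp add: lookup_add distrib_left single_add sum.distrib)
qed

lemma ncmul_zero [simp]: "ncmul 0 q = 0" "ncmul p 0 = 0"
  by (simp_all add: ncmul_def)

lemma ncmul_sum_left: "ncmul (\<Sum>i\<in>I. f i) q = (\<Sum>i\<in>I. ncmul (f i) q)"
  by (induction I rule: infinite_finite_induct) (simp_all add: ncmul_add_left)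

lemma ncmul_sum_right: "ncmul p (\<Sum>i\<in>I. f i) = (\<Sum>i\<in>I. ncmul p (f i))"
  by (induction I rule: infinite_finite_induct) (simp_all add: ncmul_add_right)

lemma ncmul_diff_left: "ncmul (p - p') q = ncmul p q - ncmul p' q"
  using ncmul_add_left[of "p - p'" p' q] by (simp add: algebra_simps)

lemma ncmul_diff_right: "ncmul p (q - q') = ncmul p q - ncmul p q'"
  using ncmul_add_right[of p "q - q'" q'] by (simp add: algebra_simps)

lemma ncmul_single:
  "ncmul (Poly_Mapping.single v c) (Poly_Mapping.single w d) = Poly_Mapping.single (v @ w) (c * d)"
  using ncmul_superset[of "{v}" "Poly_Mapping.single v c" "{w}" "Poly_Mapping.single w d"]
  by (simp add: lookup_single)

lemma single_eq_sum_keys: "p = (\<Sum>w\<in>Poly_Mapping.keys p. Poly_Mapping.single w (Poly_Mapping.lookup p w))"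
  by (rule poly_mapping_eqI) (auto simp: lookup_sum lookup_single when_def in_keys_iff sum.delta)

text \<open>\<open>nc_ideal\<close> has no rule for negation; it is multiplication by the constant
  -1.\<close>

lemma nc_ideal_uminus:
  assumes "a \<in> nc_ideal G"
  shows "- a \<in> nc_ideal G"
proof -
  have "ncmul (ncmul (Poly_Mapping.single [] (-1)) a) (Poly_Mapping.single [] 1) = - a"
  proof -
    let ?s = "\<Sum>w\<in>Poly_Mapping.keys a. Poly_Mapping.single w (Poly_Mapping.lookup a w)"
    have "ncmul (ncmul (Poly_Mapping.single [] (-1)) ?s) (Poly_Mapping.single [] 1)
        = (\<Sum>w\<in>Poly_Mapping.keys a. Poly_Mapping.single w (- Poly_Mapping.lookup a w))"
      by (simp only: ncmul_sum_right ncmul_sum_left ncmul_single append_Nil append_Nil2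
          mult_minus1 mult_1_right)
    also have "\<dots> = - ?s" by (simp add: single_uminus sum_negf)
    finally show ?thesis using single_eq_sum_keys[of a] by simp
  qed
  then show ?thesis using nc_ideal.mul[OF assms] by metis
qed

lemma nc_ideal_sum: "(\<And>i. i \<in> I \<Longrightarrow> f i \<in> nc_ideal G) \<Longrightarrow> (\<Sum>i\<in>I. f i) \<in> nc_ideal G"
  by (induction I rule: infinite_finite_induct) (auto intro: nc_ideal.zero nc_ideal.add)

lemma pknuth_nc_ideal:
  assumes "pknuth (<) u v"
  shows "Poly_Mapping.single u c - Poly_Mapping.single v c \<in> nc_ideal plac_gens"
proof -
  have gen: "Poly_Mapping.single (p @ x @ s) c - Poly_Mapping.single (p @ y @ s) c \<in> nc_ideal plac_gens"
    if "umon x - umon y \<in> plac_gens" for p s x y :: "'a list"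
  proof -
    have "ncmul (ncmul (Poly_Mapping.single p c) (umon x - umon y)) (umon s)
        = Poly_Mapping.single (p @ x @ s) c - Poly_Mapping.single (p @ y @ s) c"
      by (simp add: umon_def ncmul_diff_left ncmul_diff_right ncmul_single)
    then show ?thesis using nc_ideal.mul[OF nc_ideal.gen[OF that]] by metis
  qed
  from assms show ?thesis
  proof induction
    case (pknuth_refl w)
    then show ?case by (simp add: nc_ideal.zero)
  next
    case (pknuth_sym v w)
    then show ?case using nc_ideal_uminus by fastforce
  next
    case (pknuth_trans u v w)
    then show ?case using nc_ideal.add by fastforce
  next
    case (pknuth_swap_right a b c p s)
    then have "umon [b, a, c] - umon [b, c, a] \<in> plac_gens" unfolding plac_gens_def by blast
    then show ?case by (rule gen)
  next
    case (pknuth_swap_left b a c p s)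
    then have "umon [c, a, b] - umon [a, c, b] \<in> plac_gens" unfolding plac_gens_def by blast
    then show ?case by (rule gen)
  next
    case (pknuth_rotate a b c p s)
    then have "umon [c, a, b] - umon [b, c, a] \<in> plac_gens" unfolding plac_gens_def incomp_def by blast
    then show ?case by (rule gen)
  qed
qed

section \<open>Linear functionals that detect membership in the ideal\<close>

definition pairing :: "('a list \<Rightarrow> int) \<Rightarrow> 'a ncpoly \<Rightarrow> int" where
  "pairing \<chi> p = (\<Sum>w\<in>Poly_Mapping.keys p. Poly_Mapping.lookup p w * \<chi> w)"

lemma pairing_superset:
  "finite A \<Longrightarrow> Poly_Mapping.keys p \<subseteq> A \<Longrightarrow> pairing \<chi> p = (\<Sum>w\<in>A. Poly_Mapping.lookup p w * \<chi> w)"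
  unfolding pairing_def by (rule sum.mono_neutral_left) (auto simp: in_keys_iff)

lemma pairing_zero [simp]: "pairing \<chi> 0 = 0"
  by (simp add: pairing_def)

lemma pairing_add: "pairing \<chi> (p + q) = pairing \<chi> p + pairing \<chi> q"
proof -
  let ?A = "Poly_Mapping.keys p \<union> Poly_Mapping.keys q"
  have "Poly_Mapping.keys (p + q) \<subseteq> ?A" by (rule Poly_Mapping.keys_add)
  then show ?thesis
    using pairing_superset[of ?A _ \<chi>]
    by (simp add: lookup_add distrib_right sum.distrib)
qed

lemma pairing_diff: "pairing \<chi> (p - q) = pairing \<chi> p - pairing \<chi> q"
  using pairing_add[of \<chi> "p - q" q] by simp

lemma pairing_sum: "pairing \<chi> (\<Sum>i\<in>I. f i) = (\<Sum>i\<in>I. pairing \<chi> (f i))"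
  by (induction I rule: infinite_finite_induct) (simp_all add: pairing_add)

lemma pairing_single [simp]: "pairing \<chi> (Poly_Mapping.single w c) = c * \<chi> w"
  using pairing_superset[of "{w}" "Poly_Mapping.single w c" \<chi>] by simp

definition pknuth_invariant :: "('a::order list \<Rightarrow> int) \<Rightarrow> bool" where
  "pknuth_invariant \<chi> \<longleftrightarrow> (\<forall>u v. pknuth (<) u v \<longrightarrow> \<chi> u = \<chi> v)"

text \<open>The indicator functions of the P-Knuth classes suffice: subtracting from each word
  a chosen representative of its class changes nothing modulo the ideal.\<close>

lemma nc_idealI:
  fixes p :: "'a::order ncpoly"
  assumes "\<And>\<chi>. pknuth_invariant \<chi> \<Longrightarrow> pairing \<chi> p = 0"
  shows "p \<in> nc_ideal plac_gens"
proof -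
  define rep where "rep w = (SOME v. pknuth (<) w v)" for w :: "'a list"
  have rep: "pknuth (<) w (rep w)" for w
    unfolding rep_def by (rule someI[of _ w]) (rule pknuth_refl)
  have rep_eq: "rep u = rep v" if "pknuth (<) u v" for u v
  proof -
    \<comment> \<open>Equivalent words have the same set of candidates, so the choice operator picks
      the same representative.\<close>
    have "pknuth (<) u = pknuth (<) v"
      using pknuth_trans pknuth_sym that by (intro ext iffI) blast+
    then show ?thesis by (simp add: rep_def)
  qed
  let ?q = "\<Sum>w\<in>Poly_Mapping.keys p. Poly_Mapping.single (rep w) (Poly_Mapping.lookup p w)"
  have "?q = 0"
  proof (rule poly_mapping_eqI)
    fix v
    \<comment> \<open>Pairing \<open>p\<close> with this indicator yields exactly the coefficient of
      \<open>v\<close> in \<open>?q\<close>.\<close>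
    have "pknuth_invariant (\<lambda>w. if rep w = v then 1 else 0)"
      unfolding pknuth_invariant_def using rep_eq by simp
    from assms[OF this] show "Poly_Mapping.lookup ?q v = Poly_Mapping.lookup 0 v"
      by (simp add: pairing_def lookup_sum lookup_single when_def if_distrib cong: if_cong)
  qed
  then have "p = (\<Sum>w\<in>Poly_Mapping.keys p. Poly_Mapping.single w (Poly_Mapping.lookup p w)
      - Poly_Mapping.single (rep w) (Poly_Mapping.lookup p w))"
    using single_eq_sum_keys[of p] by (simp add: sum_subtractf)
  also have "\<dots> \<in> nc_ideal plac_gens"
    by (intro nc_ideal_sum pknuth_nc_ideal rep)
  finally show ?thesis .
qed

section \<open>Expansion of the determinant\<close>

text \<open>The length is an integer, so that a negative index gives the empty set, in accordance
  with \<open>eP\<close>.\<close>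

definition columns :: "int \<Rightarrow> 'a::order list set" where
  "columns k = {w. int (length w) = k \<and> sorted_wrt (>) w}"

lemma finite_columns: "finite (columns k :: 'a::{finite,order} list set)"
proof (rule finite_subset)
  show "(columns k :: 'a list set) \<subseteq> {w. set w \<subseteq> UNIV \<and> length w = nat k}"
    by (auto simp: columns_def)
qed (rule finite_lists_length_eq, simp)

lemma mem_listset:
  "ws \<in> listset As \<longleftrightarrow> length ws = length As \<and> (\<forall>i<length As. ws ! i \<in> As ! i)"
proof (induction As arbitrary: ws)
  case (Cons A As)
  then show ?case
    by (cases ws) (auto simp: set_Cons_def less_Suc_eq_0_disj)
qed simp

lemma ncprod_eP:
  "ncprod (map (\<lambda>i. eP (f i)) is :: 'a::{finite,order} ncpoly list)
     = (\<Sum>ws\<in>listset (map (\<lambda>i. columns (f i)) is). umon (concat ws))"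
proof (induction "is")
  case Nil
  then show ?case by (simp add: ncprod_def ncone_def)
next
  case (Cons i "is")
  let ?L = "listset (map (\<lambda>i. columns (f i)) is) :: 'a list list set"
  have "ncprod (map (\<lambda>i. eP (f i)) (i # is)) = ncmul (eP (f i)) (\<Sum>ws\<in>?L. umon (concat ws))"
    using Cons unfolding ncprod_def by (simp only: list.map foldr_Cons o_apply)
  also have "\<dots> = (\<Sum>w\<in>columns (f i). \<Sum>ws\<in>?L. umon (w @ concat ws))"
    by (simp add: eP_def columns_def ncmul_sum_left ncmul_sum_right umon_def ncmul_single,
        rule sum.swap)
  also have "\<dots> = (\<Sum>(w, ws)\<in>columns (f i) \<times> ?L. umon (concat (w # ws)))"
    by (simp add: sum.cartesian_product)
  also have "\<dots> = (\<Sum>ws\<in>(\<lambda>(w, ws). w # ws) ` (columns (f i) \<times> ?L). umon (concat ws))"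
    by (subst sum.reindex) (auto simp: inj_on_def intro!: sum.cong)
  also have "(\<lambda>(w, ws). w # ws) ` (columns (f i) \<times> ?L) = listset (map (\<lambda>i. columns (f i)) (i # is))"
    by (auto simp: set_Cons_def)
  finally show ?case .
qed

text \<open>An array is a permutation together with one decreasing word for each factor of the
  corresponding term; list positions count from 0, the columns of the diagram from 1.\<close>

definition arrays :: "nat list \<Rightarrow> ((nat \<Rightarrow> nat) \<times> 'a::order list list) set" where
  "arrays lam = {(\<pi>, ws). \<pi> permutes {1..part1 lam} \<and> length ws = part1 lam \<and>
     (\<forall>i<part1 lam. ws ! i \<in> columns (int (conjp lam (Suc i)) + int (\<pi> (Suc i)) - int (Suc i)))}"

lemma arrays_eq:
  "arrays lam = (SIGMA \<pi>:{\<pi>. \<pi> permutes {1..part1 lam}}.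
     listset (map (\<lambda>i. columns (int (conjp lam i) + int (\<pi> i) - int i)) [1..<part1 lam + 1]))"
  by (auto simp: arrays_def mem_listset simp del: upt_Suc)

lemma finite_listset: "(\<And>A. A \<in> set As \<Longrightarrow> finite A) \<Longrightarrow> finite (listset As)"
proof (induction As)
  case (Cons A As)
  have "set_Cons A (listset As) = (\<lambda>(w, ws). w # ws) ` (A \<times> listset As)"
    by (auto simp: set_Cons_def)
  with Cons show ?case by simp
qed simp

lemma finite_arrays: "finite (arrays lam :: ((nat \<Rightarrow> nat) \<times> 'a::{finite,order} list list) set)"
  unfolding arrays_eq
  by (intro finite_SigmaI finite_permutations finite_listset) (auto simp: finite_columns)

lemma pairing_Jfrak:
  "pairing \<chi> (Jfrak lam :: 'a::{finite,order} ncpoly)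
     = (\<Sum>(\<pi>, ws)\<in>arrays lam. sign \<pi> * \<chi> (concat ws))"
proof -
  have "pairing \<chi> (Jfrak lam :: 'a ncpoly) = (\<Sum>\<pi> | \<pi> permutes {1..part1 lam}.
      \<Sum>ws\<in>listset (map (\<lambda>i. columns (int (conjp lam i) + int (\<pi> i) - int i)) [1..<part1 lam + 1]).
        sign \<pi> * \<chi> (concat ws))"
    unfolding Jfrak_def Let_def
    by (simp only: ncprod_eP ncsmult_def ncmul_sum_right umon_def ncmul_single pairing_sum
        pairing_single append_Nil mult_1_right)
  also have "\<dots> = (\<Sum>(\<pi>, ws)\<in>arrays lam. sign \<pi> * \<chi> (concat ws))"
    unfolding arrays_eq
    by (intro sum.Sigma) (auto intro!: finite_permutations finite_listset simp: finite_columns)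
  finally show ?thesis .
qed

section \<open>Cancellation of flawed arrays\<close>

lemma three_one_free_order_less:
  assumes "three_plus_one_free TYPE('a::order)"
  shows "three_one_free_order ((<) :: 'a \<Rightarrow> 'a \<Rightarrow> bool)"
proof
  fix a b c d :: 'a
  assume "a < b" "b < c"
  then show "a < d \<or> d < a \<or> b < d \<or> d < b \<or> c < d \<or> d < c"
    using assms unfolding three_plus_one_free_def incomp_def by blast
qed auto

section \<open>Conjugate partitions and the diagram read by columns\<close>

lemma conjp_antimono: "c \<le> c' \<Longrightarrow> conjp lam c' \<le> conjp lam c"
proof -
  assume "c \<le> c'"
  have "length (filter (\<lambda>x. c' \<le> x) l) \<le> length (filter (\<lambda>x. c \<le> x) l)" for l :: "nat list"
    using \<open>c \<le> c'\<close> by (induction l) auto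
  then show ?thesis by (simp add: conjp_def)
qed

lemma conjp_le: "conjp lam c \<le> length lam"
  by (simp add: conjp_def)

lemma le_conjp_iff:
  assumes "sorted_wrt (\<ge>) l" "1 \<le> r"
  shows "r \<le> conjp l c \<longleftrightarrow> r \<le> length l \<and> c \<le> l ! (r - 1)"
  using assms
proof (induction l arbitrary: r)
  case (Cons x l)
  show ?case
  proof (cases "c \<le> x")
    case True
    show ?thesis
    proof (cases "r = 1")
      case False
      with Cons.prems obtain r' where r: "r = Suc r'" "1 \<le> r'" by (cases r) auto
      show ?thesis using Cons.IH[of r'] Cons.prems r True by (simp add: conjp_def)
    qed (use True in \<open>simp add: conjp_def\<close>)
  next
    case False
    then have "\<forall>y\<in>set (x # l). \<not> c \<le> y" using Cons.prems by auto
    moreover have "(x # l) ! (r - 1) \<in> set (x # l)" if "r \<le> length (x # l)"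
      using that Cons.prems(2) by (intro nth_mem) auto
    ultimately have "conjp (x # l) c = 0" "r \<le> length (x # l) \<Longrightarrow> \<not> c \<le> (x # l) ! (r - 1)"
      by (auto simp: conjp_def filter_empty_conv)
    then show ?thesis using Cons.prems(2) by auto
  qed
qed (simp add: conjp_def)

lemma mem_young:
  assumes "is_partition lam"
  shows "(r, c) \<in> young lam \<longleftrightarrow> 1 \<le> c \<and> c \<le> part1 lam \<and> 1 \<le> r \<and> r \<le> conjp lam c"
proof -
  have "c \<le> part1 lam" if "r \<le> length lam" "1 \<le> r" "c \<le> lam ! (r - 1)"
  proof (cases "r = 1")
    case True
    then show ?thesis using that by (cases lam) (auto simp: part1_def)
  next
    case False
    then have "lam ! (r - 1) \<le> lam ! 0"
      using assms that sorted_wrt_nth_less[of "(\<ge>)" lam 0 "r - 1"] by (simp add: is_partition_def)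
    then show ?thesis using that by (cases lam) (auto simp: part1_def)
  qed
  then show ?thesis
    using le_conjp_iff[of lam r c] assms by (auto simp: young_def is_partition_def)
qed

text \<open>Keeps the map of \<open>chain_pair_swap\<close> as a parameter, so that the flip of an
  array can be defined from it.\<close>

locale column_arrays =
  fixes lam :: "nat list" and g :: "'a::{finite,order} list \<times> 'a list \<Rightarrow> 'a list \<times> 'a list"
  assumes order: "three_one_free_order ((<) :: 'a \<Rightarrow> 'a \<Rightarrow> bool)"
    and inj_g: "inj_on g (three_one_free_order.chain_pairs (<) p q)"
    and g: "z \<in> three_one_free_order.chain_pairs (<) p q \<Longrightarrow>
      g z \<in> three_one_free_order.chain_pairs (<) q p"
    and g_pknuth: "z \<in> three_one_free_order.chain_pairs (<) p q \<Longrightarrow>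
      pknuth (<) (pair_word z) (pair_word (g z))"

sublocale column_arrays \<subseteq> three_one_free_order "(<) :: 'a \<Rightarrow> 'a \<Rightarrow> bool"
  by (rule order)

context column_arrays
begin

abbreviation knuth_equiv (infix "\<approx>" 50) where "u \<approx> v \<equiv> pknuth (<) u v"

text \<open>The words of an array are aligned at their first, bottommost letters, with the first letter
  of column \<open>i\<close> in row \<open>conjp lam (Suc i)\<close>. Rows are counted upwards by their depth below the row
  \<open>length lam\<close>, because the upper ends of the columns may lie above the first row.\<close>

definition off :: "nat \<Rightarrow> nat" where
  "off i = length lam - conjp lam (Suc i)"

definition cell :: "'a list list \<Rightarrow> nat \<Rightarrow> nat \<Rightarrow> 'a option" where
  "cell ws i \<rho> = (if off i \<le> \<rho> \<and> \<rho> - off i < length (ws ! i) then Some (ws ! i ! (\<rho> - off i)) else None)"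

text \<open>A missing right neighbour is a flaw above the top of column \<open>Suc i\<close>, but
  not below its first letter, where \<open>off (Suc i) \<le> \<rho>\<close> fails. So absence of
  flaws controls the column lengths as well as the rows.\<close>

definition flaw :: "'a list list \<Rightarrow> nat \<Rightarrow> nat \<Rightarrow> bool" where
  "flaw ws \<rho> i \<longleftrightarrow> Suc i < part1 lam \<and> off (Suc i) \<le> \<rho> \<and>
     (\<exists>x. cell ws i \<rho> = Some x \<and> (\<forall>y. cell ws (Suc i) \<rho> = Some y \<longrightarrow> y < x))"

definition first_row :: "'a list list \<Rightarrow> nat" where
  "first_row ws = (LEAST \<rho>. \<exists>i. flaw ws \<rho> i)"

definition first_col :: "'a list list \<Rightarrow> nat" where
  "first_col ws = (LEAST i. flaw ws (first_row ws) i)"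

definition swap_tails :: "nat \<Rightarrow> nat \<Rightarrow> 'a list \<Rightarrow> 'a list \<Rightarrow> 'a list \<times> 'a list" where
  "swap_tails m n x y = (let z = g (rev (drop m x), rev (drop n y))
     in (take m x @ rev (fst z), take n y @ rev (snd z)))"

text \<open>The head of column \<open>i\<close> includes its letter in row \<open>\<rho>\<close>,
  while the head of column \<open>Suc i\<close> stops one row lower. This offset gives the new
  columns the lengths prescribed by the permutation composed with the transposition, and keeps the
  flaw in place.\<close>

definition flip_array :: "(nat \<Rightarrow> nat) \<times> 'a list list \<Rightarrow> (nat \<Rightarrow> nat) \<times> 'a list list" where
  "flip_array = (\<lambda>(\<pi>, ws). let \<rho> = first_row ws; i = first_col ws;
     z = swap_tails (Suc (\<rho> - off i)) (\<rho> - off (Suc i)) (ws ! i) (ws ! Suc i)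
     in (\<pi> \<circ> transpose (Suc i) (Suc (Suc i)), ws[i := fst z, Suc i := snd z]))"

lemma off_mono: "off i \<le> off (Suc i)"
  using conjp_antimono[of "Suc i" "Suc (Suc i)" lam] by (simp add: off_def)

lemma first_flaw:
  assumes "flaw ws \<rho> i"
  shows "flaw ws (first_row ws) (first_col ws)"
    and "\<rho>' < first_row ws \<Longrightarrow> \<not> flaw ws \<rho>' j"
    and "j < first_col ws \<Longrightarrow> \<not> flaw ws (first_row ws) j"
proof -
  have "\<exists>i. flaw ws (first_row ws) i"
    unfolding first_row_def using assms by (intro LeastI_ex[where P = "\<lambda>\<rho>. \<exists>i. flaw ws \<rho> i"] exI)
  then show "flaw ws (first_row ws) (first_col ws)"
    unfolding first_col_def by (rule LeastI_ex)
  show "\<rho>' < first_row ws \<Longrightarrow> \<not> flaw ws \<rho>' j"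
    unfolding first_row_def using not_less_Least[where P = "\<lambda>\<rho>. \<exists>i. flaw ws \<rho> i"] by blast
  show "j < first_col ws \<Longrightarrow> \<not> flaw ws (first_row ws) j"
    unfolding first_col_def by (rule not_less_Least)
qed

lemma first_flaw_unique:
  assumes "flaw ws \<rho> i" "\<And>\<rho>' j. \<rho>' < \<rho> \<Longrightarrow> \<not> flaw ws \<rho>' j" "\<And>j. j < i \<Longrightarrow> \<not> flaw ws \<rho> j"
  shows "first_row ws = \<rho>" "first_col ws = i"
proof -
  show *: "first_row ws = \<rho>"
    unfolding first_row_def using assms by (intro Least_equality) (auto simp: not_less[symmetric])
  show "first_col ws = i"
    unfolding first_col_def * using assms by (intro Least_equality) (auto simp: not_less[symmetric])
qed

text \<open>Words decrease, so each head ends in its smallest letter and each tail starts with its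
  largest. The flaw puts the tail of \<open>y\<close> below the head of \<open>x\<close>; the rows
  below the flaw give the rest.\<close>

lemma tails:
  fixes x y :: "'a list" and a b \<rho> :: nat
  defines "m \<equiv> Suc (\<rho> - a)" and "n \<equiv> \<rho> - b"
  assumes desc: "sorted_wrt (>) x" "sorted_wrt (>) y"
    and ab: "a \<le> b" "b \<le> \<rho>" "\<rho> - a < length x"
    and bad: "\<rho> - b < length y \<Longrightarrow> y ! (\<rho> - b) < x ! (\<rho> - a)"
    and good: "\<And>\<rho>'. b \<le> \<rho>' \<Longrightarrow> \<rho>' < \<rho> \<Longrightarrow> \<rho>' - b < length y \<and> \<not> y ! (\<rho>' - b) < x ! (\<rho>' - a)"
  shows tails_length: "n \<le> length y"
    and tails_below: "z \<in> set (drop m x) \<union> set (drop n y) \<Longrightarrow> u \<in> set (take m x) \<union> set (take n y) \<Longrightarrow> z < u"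
    and tails_tab: "tab (<) (rev (take m x)) (rev (take n y))"
proof -
  show n: "n \<le> length y"
  proof (cases "\<rho> = b")
    case False
    then obtain \<rho>' where "\<rho> = Suc \<rho>'" "b \<le> \<rho>'" using ab by (cases \<rho>) auto
    then show ?thesis using good[of \<rho>'] by (simp add: n_def Suc_diff_le)
  qed (simp add: n_def)
  have x_less: "x ! j < x ! i" if "i < j" "j < length x" for i j
    using sorted_wrt_nth_less[OF desc(1)] that by blast
  have sx: "sorted_wrt (>) (take m x @ drop m x)" and sy: "sorted_wrt (>) (take n y @ drop n y)"
    using desc by simp_all
  have m: "take m x \<noteq> []" "last (take m x) = x ! (\<rho> - a)"
    using ab by (auto simp: m_def take_Suc_conv_app_nth)
  have Bx: "z < u" if "z \<in> set (drop n y)" "u \<in> set (take m x)" for z u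
  proof (rule chain_cross)
    show "chain (rev (drop n y))" "chain (rev (take m x))"
      using sx sy by (auto simp: sorted_wrt_rev sorted_wrt_append)
    assume "rev (drop n y) \<noteq> []"
    then show "last (rev (drop n y)) < hd (rev (take m x))"
      using bad m by (simp add: last_rev hd_rev hd_drop_conv_nth n_def)
  qed (use that in auto)
  \<comment> \<open>The three letters of \<open>x\<close> around row \<open>\<rho>\<close> form a
    chain, so one of them is comparable with the letter of \<open>y\<close> in the row below. That
    letter is not below the largest of the three, hence it lies above the smallest.\<close>
  have Ay: "z < u" if "z \<in> set (drop m x)" "u \<in> set (take n y)" for z u
  proof (rule chain_cross)
    show "chain (rev (drop m x))" "chain (rev (take n y))"
      using sx sy by (auto simp: sorted_wrt_rev sorted_wrt_append)
    assume *: "rev (drop m x) \<noteq> []" "rev (take n y) \<noteq> []"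
    then obtain \<rho>' where \<rho>': "\<rho> = Suc \<rho>'" "b \<le> \<rho>'"
      using ab by (cases \<rho>) (auto simp: n_def)
    have lens: "Suc (\<rho> - a) < length x" using * by (simp add: m_def)
    have "x ! Suc (\<rho> - a) < x ! (\<rho> - a)" "x ! (\<rho> - a) < x ! (\<rho>' - a)"
      using x_less lens \<rho>' ab by auto
    moreover have "\<rho>' - b < length y" "\<not> y ! (\<rho>' - b) < x ! (\<rho>' - a)" using good[of \<rho>'] \<rho>' by auto
    ultimately have "x ! Suc (\<rho> - a) < y ! (\<rho>' - b)"
      using three_one[of "x ! Suc (\<rho> - a)" "x ! (\<rho> - a)" "x ! (\<rho>' - a)" "y ! (\<rho>' - b)"]
        lt_trans by blast
    moreover have "last (take n y) = y ! (\<rho>' - b)"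
      using \<rho>' \<open>\<rho>' - b < length y\<close> by (simp add: n_def Suc_diff_le take_Suc_conv_app_nth)
    ultimately show "last (rev (drop m x)) < hd (rev (take n y))"
      using lens * by (simp add: last_rev hd_rev hd_drop_conv_nth m_def)
  qed (use that in auto)
  show "z < u" if "z \<in> set (drop m x) \<union> set (drop n y)" "u \<in> set (take m x) \<union> set (take n y)"
  proof -
    have "z < u" if "z \<in> set (drop m x)" "u \<in> set (take m x)"
      using sx[unfolded sorted_wrt_append] that by blast
    moreover have "z < u" if "z \<in> set (drop n y)" "u \<in> set (take n y)"
      using sy[unfolded sorted_wrt_append] that by blast
    ultimately show ?thesis using that Bx Ay by blast
  qed
  show "tab (<) (rev (take m x)) (rev (take n y))"
    unfolding tab_iff_nth
  proof (intro conjI allI impI)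
    show "length (rev (take n y)) \<le> length (rev (take m x))"
      using ab by (auto simp: m_def n_def)
    fix j assume "j < length (rev (take n y))"
    then have j: "j < \<rho> - b" by (simp add: n_def)
    \<comment> \<open>Aligned at their small ends, the heads are shifted by one row:
      \<open>y\<close> in row \<open>\<rho>'\<close> faces \<open>x\<close> one row higher, where
      the letter is smaller.\<close>
    define \<rho>' where "\<rho>' = \<rho> - Suc j"
    have \<rho>': "b \<le> \<rho>'" "\<rho>' < \<rho>" "\<rho> - a - j = Suc (\<rho>' - a)" "\<rho> - b - Suc j = \<rho>' - b"
      using j ab by (auto simp: \<rho>'_def)
    have "\<not> y ! (\<rho>' - b) < x ! (\<rho>' - a)" using good \<rho>' by blast
    moreover have "x ! Suc (\<rho>' - a) < x ! (\<rho>' - a)" using x_less \<rho>' ab by simp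
    ultimately have "\<not> y ! (\<rho>' - b) < x ! Suc (\<rho>' - a)" using lt_trans by blast
    moreover have "rev (take n y) ! j = y ! (\<rho>' - b)"
      using j n \<rho>' by (simp add: rev_nth n_def min_def)
    moreover have "rev (take m x) ! j = x ! Suc (\<rho>' - a)"
    proof -
      have l: "length (take m x) = Suc (\<rho> - a)" "j < Suc (\<rho> - a)" "Suc (\<rho>' - a) < m"
        using j ab \<rho>' by (auto simp: m_def)
      have "rev (take m x) ! j = take m x ! (\<rho> - a - j)" using l by (simp add: rev_nth)
      then show ?thesis using l unfolding \<rho>'(3) by simp
    qed
    ultimately show "\<not> rev (take n y) ! j < rev (take m x) ! j" by simp
  qed
qed

text \<open>Besides the old tail, the new one must be passed too, in the backward direction:
  \<open>UVA'B'\<close> becomes \<open>UA'VB'\<close>. This is possible because \<open>g\<close>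
  preserves the letters.\<close>

lemma swap_tails:
  fixes x y :: "'a list"
  assumes desc: "sorted_wrt (>) x" "sorted_wrt (>) y"
    and below: "\<And>z u. z \<in> set (drop m x) \<union> set (drop n y) \<Longrightarrow> u \<in> set (take m x) \<union> set (take n y) \<Longrightarrow> z < u"
    and tab: "tab (<) (rev (take m x)) (rev (take n y))"
    and len: "m \<le> length x" "n \<le> length y"
    and sw: "swap_tails m n x y = (x', y')"
  shows "sorted_wrt (>) x'" "sorted_wrt (>) y'"
    and "length x' = m + (length y - n)" "length y' = n + (length x - m)"
    and "take m x' = take m x" "take n y' = take n y"
    and "(rev (drop m x'), rev (drop n y')) = g (rev (drop m x), rev (drop n y))"
    and "set (drop n y') \<subseteq> set (drop m x) \<union> set (drop n y)"
    and "x @ y \<approx> x' @ y'"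
proof -
  define U V A B where "U = take m x" and "V = take n y" and "A = drop m x" and "B = drop n y"
  have xy: "x = U @ A" "y = V @ B" by (simp_all add: U_def V_def A_def B_def)
  obtain A' B' where z: "g (rev A, rev B) = (rev A', rev B')"
    by (metis rev_rev_ident surj_pair)
  then have x'y': "x' = U @ A'" "y' = V @ B'"
    using sw by (auto simp: swap_tails_def Let_def U_def V_def A_def B_def)
  have AB: "(rev A, rev B) \<in> chain_pairs (length A) (length B)"
    using desc[unfolded xy] by (auto simp: chain_pairs_def sorted_wrt_rev sorted_wrt_append)
  from g[OF this] have A'B': "sorted_wrt (>) A'" "sorted_wrt (>) B'" "length A' = length B" "length B' = length A"
    by (auto simp: z chain_pairs_def sorted_wrt_rev)
  have pk: "A @ B \<approx> A' @ B'" using g_pknuth[OF AB] by (simp add: z pair_word_def)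
  have set: "set A' \<union> set B' = set A \<union> set B"
    using mset_eq_setD[OF pknuth_mset[OF pk]] by auto
  have bel: "\<And>z u. z \<in> set A \<union> set B \<Longrightarrow> u \<in> set U \<union> set V \<Longrightarrow> z < u"
    using below by (simp add: U_def V_def A_def B_def)
  have UV: "sorted_wrt (>) U" "sorted_wrt (>) V" "sorted_wrt (>) A"
    using desc[unfolded xy] by (auto simp: sorted_wrt_append)
  have pass: "U @ C @ V \<approx> U @ V @ C" if C: "sorted_wrt (>) C" "set C \<subseteq> set A \<union> set B" for C
  proof -
    have "rev (rev U) @ rev (rev C) @ rev (rev V) \<approx> rev (rev U) @ rev (rev V) @ rev (rev C)"
    proof (rule pass_below)
      show "chain (rev C @ rev U)" "chain (rev V)"
        using C UV bel by (auto simp: sorted_wrt_append sorted_wrt_rev)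
      show "tab (<) (rev U) (rev V)" using tab by (simp add: U_def V_def)
    qed (use C bel in auto)
    then show ?thesis by simp
  qed
  have lens: "length U = m" "length V = n" using len by (simp_all add: U_def V_def)
  show "sorted_wrt (>) x'" "sorted_wrt (>) y'"
    using UV A'B' bel set unfolding x'y' by (auto simp: sorted_wrt_append)
  show "length x' = m + (length y - n)" "length y' = n + (length x - m)"
    using A'B' lens unfolding x'y' xy by auto
  show "take m x' = take m x" "take n y' = take n y"
    using lens unfolding x'y' by (auto simp: U_def V_def)
  show "(rev (drop m x'), rev (drop n y')) = g (rev (drop m x), rev (drop n y))"
    using z lens unfolding x'y' by (simp add: A_def B_def)
  show "set (drop n y') \<subseteq> set (drop m x) \<union> set (drop n y)"
    using set lens unfolding x'y' by (auto simp: A_def B_def)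
  have "x @ y \<approx> U @ V @ A @ B"
    using pknuth_context[OF pass[of A], of "[]" B] UV unfolding xy by simp
  also have "\<dots> \<approx> U @ V @ A' @ B'"
    using pknuth_context[OF pk, of "U @ V" "[]"] by simp
  also have "\<dots> \<approx> x' @ y'"
    using pknuth_context[OF pknuth_sym[OF pass[of A']], of "[]" B'] A'B' set unfolding x'y' by auto
  finally show "x @ y \<approx> x' @ y'" .
qed

section \<open>The sign-reversing map on flawed arrays\<close>

definition flawed :: "((nat \<Rightarrow> nat) \<times> 'a list list) set" where
  "flawed = {(\<pi>, ws) \<in> arrays lam. \<exists>\<rho> i. flaw ws \<rho> i}"

lemma arraysD:
  assumes "(\<pi>, ws) \<in> arrays lam" "i < part1 lam"
  shows "sorted_wrt (>) (ws ! i)"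
    and "int (off i) + int (length (ws ! i)) = int (length lam) + int (\<pi> (Suc i)) - int (Suc i)"
  using assms conjp_le[of lam "Suc i"] by (auto simp: arrays_def columns_def off_def of_nat_diff)

lemma concat_two:
  assumes "Suc i < length ws"
  shows "concat (ws[i := x, Suc i := y]) = concat (take i ws) @ x @ y @ concat (drop (Suc (Suc i)) ws)"
proof -
  have "ws = take i ws @ ws ! i # ws ! Suc i # drop (Suc (Suc i)) ws"
    using assms by (metis Cons_nth_drop_Suc Suc_lessD append_take_drop_id)
  then have "ws[i := x, Suc i := y] = (take i ws @ ws ! i # ws ! Suc i # drop (Suc (Suc i)) ws)[i := x, Suc i := y]"
    by simp
  also have "\<dots> = take i ws @ x # y # drop (Suc (Suc i)) ws"
    using assms by (simp add: list_update_append min_def)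
  finally show ?thesis by simp
qed

text \<open>The flip preserves the position of the first flaw, so the places where the columns were
  cut can be read off the result.\<close>

lemma flip_array:
  assumes F: "(\<pi>, ws) \<in> flawed"
    and \<rho>: "\<rho> = first_row ws" and i: "i = first_col ws"
    and m: "m = Suc (\<rho> - off i)" and n: "n = \<rho> - off (Suc i)"
    and flip: "flip_array (\<pi>, ws) = (\<pi>', ws')"
  shows "(\<pi>', ws') \<in> flawed" "first_row ws' = \<rho>" "first_col ws' = i"
    and "Suc i < part1 lam"
    and "\<pi>' = \<pi> \<circ> transpose (Suc i) (Suc (Suc i))"
    and "ws' = ws[i := ws' ! i, Suc i := ws' ! Suc i]"
    and "take m (ws' ! i) = take m (ws ! i)" "take n (ws' ! Suc i) = take n (ws ! Suc i)"
    and "(rev (drop m (ws' ! i)), rev (drop n (ws' ! Suc i)))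
       = g (rev (drop m (ws ! i)), rev (drop n (ws ! Suc i)))"
    and "concat ws \<approx> concat ws'"
proof -
  obtain \<rho>0 i0 where ar: "(\<pi>, ws) \<in> arrays lam" and "flaw ws \<rho>0 i0"
    using F by (auto simp: flawed_def)
  note fl = first_flaw[OF this(2), folded \<rho> i]
  let ?k = "part1 lam"
  let ?x = "ws ! i" and ?y = "ws ! Suc i"
  show ik: "Suc i < ?k" using fl(1) by (simp add: flaw_def)
  have len: "length ws = ?k" and perm: "\<pi> permutes {1..?k}" using ar by (auto simp: arrays_def)
  note x = arraysD[OF ar Suc_lessD[OF ik]] and y = arraysD[OF ar ik]
  have ab: "off i \<le> off (Suc i)" "off (Suc i) \<le> \<rho>" "\<rho> - off i < length ?x" "off i \<le> \<rho>"
    using fl(1) off_mono[of i] by (auto simp: flaw_def cell_def split: if_splits)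
  have bad: "?y ! (\<rho> - off (Suc i)) < ?x ! (\<rho> - off i)" if "\<rho> - off (Suc i) < length ?y"
    using fl(1) that by (auto simp: flaw_def cell_def split: if_splits)
  have good: "\<rho>' - off (Suc i) < length ?y \<and> \<not> ?y ! (\<rho>' - off (Suc i)) < ?x ! (\<rho>' - off i)"
    if "off (Suc i) \<le> \<rho>'" "\<rho>' < \<rho>" for \<rho>'
  proof -
    have "off i \<le> \<rho>'" "\<rho>' - off i < length ?x" using that ab by auto
    then show ?thesis using fl(2)[OF that(2), of i] that ik
      by (auto simp: flaw_def cell_def split: if_splits)
  qed
  note t = tails[OF x(1) y(1) ab(1-3) bad good, folded m n]
  have n_le: "n \<le> length ?y" using t(1) by blast
  have below: "z < u" if "z \<in> set (drop m ?x) \<union> set (drop n ?y)" "u \<in> set (take m ?x) \<union> set (take n ?y)" for z u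
    using t(2) that by blast
  have tab: "tab (<) (rev (take m ?x)) (rev (take n ?y))" using t(3) by blast
  have m_le: "m \<le> length ?x" using ab m by simp
  obtain x' y' where sw: "swap_tails m n ?x ?y = (x', y')" by fastforce
  note s = swap_tails[OF x(1) y(1) below tab m_le n_le sw]
  have fl_eq: "\<pi>' = \<pi> \<circ> transpose (Suc i) (Suc (Suc i))" "ws' = ws[i := x', Suc i := y']"
    using flip sw by (auto simp: flip_array_def \<rho>[symmetric] i[symmetric] m[symmetric] n[symmetric])
  show "\<pi>' = \<pi> \<circ> transpose (Suc i) (Suc (Suc i))" by (rule fl_eq)
  have nth: "ws' ! i = x'" "ws' ! Suc i = y'" "\<And>c. c \<noteq> i \<Longrightarrow> c \<noteq> Suc i \<Longrightarrow> ws' ! c = ws ! c"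
    "length ws' = ?k"
    using ik len by (auto simp: fl_eq nth_list_update)
  show "ws' = ws[i := ws' ! i, Suc i := ws' ! Suc i]" unfolding nth(1,2) by (rule fl_eq)
  show "take m (ws' ! i) = take m ?x" "take n (ws' ! Suc i) = take n ?y"
    "(rev (drop m (ws' ! i)), rev (drop n (ws' ! Suc i))) = g (rev (drop m ?x), rev (drop n ?y))"
    unfolding nth using s by auto
  show "concat ws \<approx> concat ws'"
  proof -
    have "concat ws = concat (take i ws) @ (?x @ ?y) @ concat (drop (Suc (Suc i)) ws)"
      using concat_two[of i ws ?x ?y] ik len by simp
    moreover have "concat ws' = concat (take i ws) @ (x' @ y') @ concat (drop (Suc (Suc i)) ws)"
      using concat_two[of i ws x' y'] ik len by (simp add: fl_eq)
    ultimately show ?thesis using pknuth_context[OF s(9)] by metis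
  qed

  have nth_x: "x' ! t = ?x ! t" if "t < m" for t
    using s(5) that by (metis nth_take)
  have nth_y: "y' ! t = ?y ! t" if "t < n" for t
    using s(6) that by (metis nth_take)
  \<comment> \<open>Up to row \<open>\<rho>\<close> the only cell that may change is the one to the
    right of the flaw.\<close>
  have cell_eq: "cell ws' c \<rho>' = cell ws c \<rho>'" if "\<rho>' < \<rho> \<or> \<rho>' = \<rho> \<and> c \<noteq> Suc i" for c \<rho>'
  proof -
    consider "c = i" | "c = Suc i" | "c \<noteq> i" "c \<noteq> Suc i" by blast
    then show ?thesis
    proof cases
      case 1
      have "off i \<le> \<rho>' \<Longrightarrow> \<rho>' - off i < m" using that m by auto
      then show ?thesis using 1 nth s(3) m_le nth_x by (auto simp: cell_def)
    next
      case 2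
      have "off (Suc i) \<le> \<rho>' \<Longrightarrow> \<rho>' - off (Suc i) < n" using that 2 n by auto
      then show ?thesis using 2 nth s(4) n_le nth_y by (auto simp: cell_def)
    qed (simp add: cell_def nth)
  qed
  \<comment> \<open>Whatever letter arrives to the right of the flaw comes from the old tails, hence
    lies below the letter of column \<open>i\<close>, which stayed in its head.\<close>
  have new: "flaw ws' \<rho> i"
  proof -
    have "cell ws' i \<rho> = Some (?x ! (\<rho> - off i))"
      using cell_eq[of \<rho> i] ab by (simp add: cell_def)
    moreover have "v < ?x ! (\<rho> - off i)" if "cell ws' (Suc i) \<rho> = Some v" for v
    proof -
      have "n < length y'" "v = y' ! n"
        using that nth n by (auto simp: cell_def split: if_splits)
      then have "v \<in> set (drop n y')" by (metis in_set_conv_nth hd_drop_conv_nth hd_in_set drop_eq_Nil not_less)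
      then have "v \<in> set (drop m ?x) \<union> set (drop n ?y)" using s(8) by blast
      moreover have "?x ! (\<rho> - off i) \<in> set (take m ?x)"
        using ab m by (simp add: take_Suc_conv_app_nth)
      ultimately show ?thesis using below by blast
    qed
    ultimately show ?thesis using ik ab by (auto simp: flaw_def)
  qed
  have old: "\<not> flaw ws' \<rho>' j" if "\<rho>' < \<rho>" for \<rho>' j
    using fl(2)[OF that, of j] cell_eq[of \<rho>' j] cell_eq[of \<rho>' "Suc j"] that by (simp add: flaw_def)
  have left: "\<not> flaw ws' \<rho> j" if "j < i" for j
    using fl(3)[OF that] cell_eq[of \<rho> j] cell_eq[of \<rho> "Suc j"] that by (simp add: flaw_def)
  show "first_row ws' = \<rho>" "first_col ws' = i"
    using first_flaw_unique[OF new old left] by auto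

  have perm': "\<pi>' permutes {1..?k}"
    unfolding fl_eq using ik by (intro permutes_compose[OF _ perm] permutes_swap_id) auto
  have lx: "int (length x') = int (conjp lam (Suc i)) + int (\<pi> (Suc (Suc i))) - int (Suc i)"
  proof -
    have "int (length x') = 1 + int (off (Suc i)) - int (off i) + int (length ?y)"
      using s(3) ab m n n_le by (simp add: of_nat_diff)
    then show ?thesis using y(2) conjp_le[of lam "Suc i"] by (simp add: off_def of_nat_diff)
  qed
  have ly: "int (length y') = int (conjp lam (Suc (Suc i))) + int (\<pi> (Suc i)) - int (Suc (Suc i))"
  proof -
    have "int (length y') = int (off i) - int (off (Suc i)) + int (length ?x) - 1"
      using s(4) ab m n m_le by (simp add: of_nat_diff)
    then show ?thesis using x(2) conjp_le[of lam "Suc (Suc i)"] by (simp add: off_def of_nat_diff)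
  qed
  have "ws' ! c \<in> columns (int (conjp lam (Suc c)) + int (\<pi>' (Suc c)) - int (Suc c))" if "c < ?k" for c
  proof -
    consider "c = i" | "c = Suc i" | "c \<noteq> i" "c \<noteq> Suc i" by blast
    then show ?thesis
    proof cases
      case 1
      then show ?thesis using lx s(1) by (simp add: nth fl_eq(1) columns_def)
    next
      case 2
      then show ?thesis using ly s(2) by (simp add: nth fl_eq(1) columns_def)
    next
      case 3
      then have "\<pi>' (Suc c) = \<pi> (Suc c)" by (simp add: fl_eq(1) transpose_def)
      then show ?thesis using 3 ar that by (simp add: nth arrays_def)
    qed
  qed
  then show "(\<pi>', ws') \<in> flawed"
    using perm' nth(4) new by (auto simp: flawed_def arrays_def)
qed

lemma inj_on_flip_array: "inj_on flip_array flawed"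
proof (rule inj_onI)
  fix a1 a2 assume a: "a1 \<in> flawed" "a2 \<in> flawed" and eq: "flip_array a1 = flip_array a2"
  obtain \<pi>1 ws1 where 1: "a1 = (\<pi>1, ws1)" by fastforce
  obtain \<pi>2 ws2 where 2: "a2 = (\<pi>2, ws2)" by fastforce
  obtain \<pi>' ws' where e: "flip_array a1 = (\<pi>', ws')" by fastforce
  define \<rho> i where "\<rho> = first_row ws'" and "i = first_col ws'"
  define m n where "m = Suc (\<rho> - off i)" and "n = \<rho> - off (Suc i)"
  have ri: "\<rho> = first_row ws1" "i = first_col ws1" "\<rho> = first_row ws2" "i = first_col ws2"
    using flip_array(2,3)[OF a(1)[unfolded 1] refl refl refl refl e[unfolded 1]]
      flip_array(2,3)[OF a(2)[unfolded 2] refl refl refl refl e[unfolded eq 2]]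
    by (auto simp: \<rho>_def i_def)
  note f1 = flip_array[OF a(1)[unfolded 1] ri(1,2) m_def n_def e[unfolded 1]]
  note f2 = flip_array[OF a(2)[unfolded 2] ri(3,4) m_def n_def e[unfolded eq 2]]
  have ar: "(\<pi>1, ws1) \<in> arrays lam" "(\<pi>2, ws2) \<in> arrays lam"
    using a 1 2 by (auto simp: flawed_def)
  have len: "length ws1 = part1 lam" "length ws2 = part1 lam" using ar by (auto simp: arrays_def)
  let ?z = "\<lambda>ws. (rev (drop m (ws ! i)), rev (drop n (ws ! Suc i)))"
  have z: "?z ws \<in> chain_pairs (length (drop m (ws ! i))) (length (drop n (ws ! Suc i)))"
    if "(\<pi>, ws) \<in> arrays lam" for \<pi> ws
    using arraysD(1)[OF that, of i] arraysD(1)[OF that, of "Suc i"] f1(4)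
    by (auto simp: chain_pairs_def sorted_wrt_rev intro: sorted_wrt_drop)
  have gz: "g (?z ws1) = ?z ws'" "g (?z ws2) = ?z ws'" using f1(9) f2(9) by auto
  \<comment> \<open>\<open>g\<close> is injective only among pairs of given lengths. It exchanges
    lengths, so those of the tails are determined by the common image.\<close>
  have "length (drop m (ws1 ! i)) = length (drop m (ws2 ! i))"
    "length (drop n (ws1 ! Suc i)) = length (drop n (ws2 ! Suc i))"
    using g[OF z[OF ar(1)]] g[OF z[OF ar(2)]] unfolding gz by (auto simp: chain_pairs_def)
  then have "?z ws1 = ?z ws2"
    using inj_onD[OF inj_g _ z[OF ar(1)], of "?z ws2"] z[OF ar(2)] gz by metis
  then have "drop m (ws1 ! i) = drop m (ws2 ! i)" "drop n (ws1 ! Suc i) = drop n (ws2 ! Suc i)"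
    by auto
  moreover have "take m (ws1 ! i) = take m (ws2 ! i)" "take n (ws1 ! Suc i) = take n (ws2 ! Suc i)"
    using f1(7,8) f2(7,8) by auto
  ultimately have i_eq: "ws1 ! i = ws2 ! i" "ws1 ! Suc i = ws2 ! Suc i"
    by (metis append_take_drop_id)+
  have "ws1 = ws2"
  proof (rule nth_equalityI)
    fix c assume "c < length ws1"
    have "ws' ! c = ws1 ! c" "ws' ! c = ws2 ! c" if "c \<noteq> i" "c \<noteq> Suc i"
      using arg_cong[OF f1(6), of "\<lambda>w. w ! c"] arg_cong[OF f2(6), of "\<lambda>w. w ! c"] that by simp_all
    then show "ws1 ! c = ws2 ! c" using i_eq by metis
  qed (simp add: len)
  moreover have "\<pi>1 = \<pi>2"
  proof -
    have "\<pi>1 \<circ> transpose (Suc i) (Suc (Suc i)) = \<pi>2 \<circ> transpose (Suc i) (Suc (Suc i))"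
      using f1(5) f2(5) by simp
    then have "\<pi>1 \<circ> transpose (Suc i) (Suc (Suc i)) \<circ> transpose (Suc i) (Suc (Suc i))
        = \<pi>2 \<circ> transpose (Suc i) (Suc (Suc i)) \<circ> transpose (Suc i) (Suc (Suc i))"
      by simp
    then show ?thesis by (simp only: comp_assoc transpose_comp_involutory comp_id)
  qed
  ultimately show "a1 = a2" by (simp add: 1 2)
qed

lemma finite_flawed: "finite flawed"
  using finite_arrays[of lam] by (rule rev_finite_subset) (auto simp: flawed_def)

text \<open>\<open>flip_array\<close> need not be an involution. By finiteness it permutes the
  flawed arrays, so the sum equals its own negative.\<close>

lemma sum_flawed:
  assumes "pknuth_invariant \<chi>"
  shows "(\<Sum>(\<pi>, ws)\<in>flawed. sign \<pi> * \<chi> (concat ws)) = 0"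
proof -
  let ?f = "\<lambda>(\<pi>, ws). sign \<pi> * \<chi> (concat ws)"
  have neg: "flip_array a \<in> flawed \<and> ?f (flip_array a) = - ?f a" if a: "a \<in> flawed" for a
  proof -
    obtain \<pi> ws where p: "a = (\<pi>, ws)" by fastforce
    obtain \<pi>' ws' where e: "flip_array (\<pi>, ws) = (\<pi>', ws')" by fastforce
    note f = flip_array[OF a[unfolded p] refl refl refl refl e]
    have "\<pi> permutes {1..part1 lam}" using a by (auto simp: p flawed_def arrays_def)
    then have "permutation \<pi>" unfolding permutation_permutes by blast
    then have "sign \<pi>' = - sign \<pi>"
      unfolding f(5) by (subst sign_compose) (auto simp: permutation_swap_id sign_swap_id)
    moreover have "\<chi> (concat ws) = \<chi> (concat ws')"
      using assms f(10) by (auto simp: pknuth_invariant_def)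
    ultimately show ?thesis using f(1) by (simp add: p e)
  qed
  have "flip_array ` flawed = flawed"
    using endo_inj_surj[OF finite_flawed _ inj_on_flip_array] neg by blast
  then have "sum ?f flawed = sum ?f (flip_array ` flawed)" by simp
  also have "\<dots> = (\<Sum>a\<in>flawed. ?f (flip_array a))"
    by (simp add: sum.reindex[OF inj_on_flip_array])
  also have "\<dots> = - sum ?f flawed"
    unfolding sum_negf[symmetric] using neg by (intro sum.cong) blast+
  finally show ?thesis by simp
qed

section \<open>Flawless arrays are P-tableaux\<close>

text \<open>Column \<open>i\<close> ends at depth \<open>length lam + \<pi> (Suc i) - Suc i\<close>.
  At a descent of \<open>\<pi>\<close> the right column ends strictly lower than the left one, and
  the row just above its end has a flaw. So \<open>\<pi>\<close> increases and is the
  identity.\<close>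

lemma flawless_perm:
  assumes ar: "(\<pi>, ws) \<in> arrays lam" and nf: "\<And>\<rho> i. \<not> flaw ws \<rho> i"
  shows "\<pi> = id"
proof -
  let ?k = "part1 lam"
  have perm: "\<pi> permutes {1..?k}" using ar by (simp add: arrays_def)
  have step: "\<pi> (Suc i) < \<pi> (Suc (Suc i))" if i: "Suc i < ?k" for i
  proof (rule ccontr)
    assume "\<not> \<pi> (Suc i) < \<pi> (Suc (Suc i))"
    then have "int (\<pi> (Suc (Suc i))) \<le> int (\<pi> (Suc i))" by simp
    then have *: "off (Suc i) + length (ws ! Suc i) < off i + length (ws ! i)"
      using arraysD(2)[OF ar i] arraysD(2)[OF ar Suc_lessD[OF i]] by linarith
    then have "flaw ws (off (Suc i) + length (ws ! Suc i)) i"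
      using i off_mono[of i] by (auto simp: flaw_def cell_def)
    with nf show False by blast
  qed
  have "Suc i \<le> \<pi> (Suc i)" if "i < ?k" for i
    using that
  proof (induction i)
    case 0
    then show ?case using permutes_in_image[OF perm, of 1] by simp
  next
    case (Suc i)
    then show ?case using step[of i] by simp
  qed
  then have "\<forall>j\<in>{1..?k}. j \<le> \<pi> j"
    by (metis Suc_le_lessD Suc_pred atLeastAtMost_iff less_eq_Suc_le One_nat_def)
  with perm show ?thesis by (rule permutes_natset_ge)
qed

definition flawless :: "((nat \<Rightarrow> nat) \<times> 'a list list) set" where
  "flawless = {(\<pi>, ws) \<in> arrays lam. \<forall>\<rho> i. \<not> flaw ws \<rho> i}"

definition tableau_columns :: "(nat \<times> nat \<Rightarrow> 'a) \<Rightarrow> 'a list list" where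
  "tableau_columns T =
     map (\<lambda>c. map (\<lambda>r. T (r, c)) (rev [1..<conjp lam c + 1])) [1..<part1 lam + 1]"

definition tableau_array :: "(nat \<times> nat \<Rightarrow> 'a) \<Rightarrow> (nat \<Rightarrow> nat) \<times> 'a list list" where
  "tableau_array T = (id, tableau_columns T)"

lemma tableau_columns_nth:
  assumes "i < part1 lam"
  shows "length (tableau_columns T ! i) = conjp lam (Suc i)"
    and "t < conjp lam (Suc i) \<Longrightarrow> tableau_columns T ! i ! t = T (conjp lam (Suc i) - t, Suc i)"
  using assms by (simp_all add: tableau_columns_def rev_nth Suc_diff_Suc del: upt_Suc)

text \<open>Translates depths into diagram rows: depth \<open>\<rho>\<close> is row
  \<open>length lam - \<rho>\<close>, and words read their column from the bottom.\<close>

lemma cell_tableau: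
  assumes "i < part1 lam" "off i \<le> \<rho>" "\<rho> < length lam" "length (ws ! i) = conjp lam (Suc i)"
  shows "cell ws i \<rho> = Some (ws ! i ! (conjp lam (Suc i) - (length lam - \<rho>)))"
    and "length lam - \<rho> \<le> conjp lam (Suc i)"
proof -
  have "\<rho> - off i = conjp lam (Suc i) - (length lam - \<rho>)" "\<rho> - off i < conjp lam (Suc i)"
    using assms conjp_le[of lam "Suc i"] by (auto simp: off_def)
  then show "cell ws i \<rho> = Some (ws ! i ! (conjp lam (Suc i) - (length lam - \<rho>)))"
    using assms by (simp add: cell_def)
  show "length lam - \<rho> \<le> conjp lam (Suc i)" using assms by (simp add: off_def)
qed

lemma bij_betw_tableaux:
  assumes "is_partition lam"
  shows "bij_betw tableau_array (SSYT_P lam) flawless"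
proof (rule bij_betw_imageI)
  note young = mem_young[OF assms]
  let ?k = "part1 lam"
  show "inj_on tableau_array (SSYT_P lam)"
  proof (rule inj_onI)
    fix T T' :: "nat \<times> nat \<Rightarrow> 'a"
    assume T: "T \<in> SSYT_P lam" "T' \<in> SSYT_P lam"
      and eq: "tableau_array T = tableau_array T'"
    have "T (r, c) = T' (r, c)" if y: "(r, c) \<in> young lam" for r c
    proof -
      obtain i where c: "c = Suc i" "i < ?k" using y young by (cases c) auto
      have r: "1 \<le> r" "r \<le> conjp lam (Suc i)" using y young c by auto
      have "tableau_columns T ! i ! (conjp lam (Suc i) - r)
          = tableau_columns T' ! i ! (conjp lam (Suc i) - r)" using eq by (simp add: tableau_array_def)
      then show ?thesis using tableau_columns_nth(2)[OF c(2)] r c by simp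
    qed
    then show "T = T'"
      using T unfolding SSYT_P_def by (auto intro!: PiE_ext[of T "young lam" "\<lambda>_. UNIV" T'])
  qed
  show "tableau_array ` SSYT_P lam = flawless"
  proof (intro subset_antisym subsetI)
    fix a assume "a \<in> tableau_array ` SSYT_P lam"
    then obtain T where a: "a = (id, tableau_columns T)" and T: "T \<in> SSYT_P lam"
      by (auto simp: tableau_array_def)
    let ?ws = "tableau_columns T"
    have col: "?ws ! i \<in> columns (int (conjp lam (Suc i)))" if i: "i < ?k" for i
    proof -
      have "?ws ! i ! Suc t < ?ws ! i ! t" if t: "Suc t < conjp lam (Suc i)" for t
      proof -
        define r where "r = conjp lam (Suc i) - Suc t"
        have r: "conjp lam (Suc i) - t = Suc r" using t by (simp add: r_def)
        have "(r, Suc i) \<in> young lam" "(r + 1, Suc i) \<in> young lam"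
          using i t young by (auto simp: r_def)
        then have "T (r, Suc i) < T (r + 1, Suc i)" using T by (auto simp: SSYT_P_def)
        then show ?thesis using tableau_columns_nth(2)[OF i] t r by (simp add: r_def)
      qed
      moreover have "transp ((>) :: 'a \<Rightarrow> 'a \<Rightarrow> bool)" by (auto intro: transpI)
      ultimately have "sorted_wrt (>) (?ws ! i)"
        using tableau_columns_nth(1)[OF i] by (simp add: sorted_wrt_iff_nth_Suc_transp)
      then show ?thesis using tableau_columns_nth(1)[OF i] by (simp add: columns_def)
    qed
    have "\<not> flaw ?ws \<rho> i" for \<rho> i
    proof
      assume fl: "flaw ?ws \<rho> i"
      then have i: "Suc i < ?k" "i < ?k" and le: "off (Suc i) \<le> \<rho>" "off i \<le> \<rho>"
        using off_mono[of i] by (auto simp: flaw_def)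
      have "\<rho> - off i < conjp lam (Suc i)"
        using fl tableau_columns_nth(1)[OF i(2)] by (auto simp: flaw_def cell_def split: if_splits)
      \<comment> \<open>All columns of a tableau end at depth \<open>length lam\<close>, so the
        right neighbour exists and the flaw must be a violation of the row condition.\<close>
      then have \<rho>: "\<rho> < length lam" using le conjp_le[of lam "Suc i"] by (simp add: off_def)
      define r where "r = length lam - \<rho>"
      note c1 = cell_tableau[OF i(2) le(2) \<rho> tableau_columns_nth(1)[OF i(2), of T], folded r_def]
      note c2 = cell_tableau[OF i(1) le(1) \<rho> tableau_columns_nth(1)[OF i(1), of T], folded r_def]
      have r: "1 \<le> r" using \<rho> by (simp add: r_def)
      have "cell ?ws i \<rho> = Some (T (r, Suc i))" "cell ?ws (Suc i) \<rho> = Some (T (r, Suc (Suc i)))"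
        using c1 c2 r tableau_columns_nth(2)[OF i(1), of _ T] tableau_columns_nth(2)[OF i(2), of _ T]
        by auto
      then have "T (r, Suc i + 1) < T (r, Suc i)" using fl by (auto simp: flaw_def)
      moreover have "(r, Suc i) \<in> young lam" "(r, Suc i + 1) \<in> young lam"
        using young i r c1(2) c2(2) by auto
      ultimately show False using T unfolding SSYT_P_def by blast
    qed
    then show "a \<in> flawless"
      using col by (auto simp: a flawless_def arrays_def permutes_id tableau_columns_def simp del: upt_Suc)
  next
    fix a assume "a \<in> flawless"
    then obtain \<pi> ws where "a = (\<pi>, ws)" and ar': "(\<pi>, ws) \<in> arrays lam"
      and nf: "\<And>\<rho> i. \<not> flaw ws \<rho> i" by (auto simp: flawless_def)
    moreover have "\<pi> = id" by (rule flawless_perm[OF ar' nf])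
    ultimately have a: "a = (id, ws)" and ar: "(id, ws) \<in> arrays lam" by auto
    have len: "length ws = ?k" using ar by (simp add: arrays_def)
    have col: "sorted_wrt (>) (ws ! i)" "length (ws ! i) = conjp lam (Suc i)" if "i < ?k" for i
      using ar that by (auto simp: arrays_def columns_def)
    define T where "T = restrict (\<lambda>(r, c). ws ! (c - 1) ! (conjp lam c - r)) (young lam)"
    have T_eq: "T (r, Suc i) = ws ! i ! (conjp lam (Suc i) - r)"
      if "i < ?k" "1 \<le> r" "r \<le> conjp lam (Suc i)" for r i
      using that young by (simp add: T_def)
    have "T (r, c) < T (r + 1, c)" if y: "(r, c) \<in> young lam" "(r + 1, c) \<in> young lam" for r c
    proof -
      obtain i where c: "c = Suc i" "i < ?k" using y young by (cases c) auto
      have r: "1 \<le> r" "r + 1 \<le> conjp lam (Suc i)" using y young c by auto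
      have "ws ! i ! (conjp lam (Suc i) - r) < ws ! i ! (conjp lam (Suc i) - (r + 1))"
        using sorted_wrt_nth_less[OF col(1)[OF c(2)]] r col(2)[OF c(2)] by simp
      then show ?thesis using T_eq[of i r] T_eq[of i "r + 1"] r c by simp
    qed
    moreover have "\<not> T (r, c + 1) < T (r, c)" if y: "(r, c) \<in> young lam" "(r, c + 1) \<in> young lam" for r c
    proof
      assume less: "T (r, c + 1) < T (r, c)"
      obtain i where c: "c = Suc i" "i < ?k" using y young by (cases c) auto
      have i: "Suc i < ?k" and r: "1 \<le> r" "r \<le> conjp lam (Suc i)" "r \<le> conjp lam (Suc (Suc i))"
        using y young c by auto
      define \<rho> where "\<rho> = length lam - r"
      have r_le: "r \<le> length lam" using r(2) conjp_le[of lam "Suc i"] by simp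
      have \<rho>: "\<rho> < length lam" "length lam - \<rho> = r" "off i \<le> \<rho>" "off (Suc i) \<le> \<rho>"
        using r r_le by (auto simp: \<rho>_def off_def)
      have "cell ws i \<rho> = Some (T (r, c))"
        using cell_tableau(1)[OF c(2) \<rho>(3,1) col(2)[OF c(2)]] T_eq[OF c(2) r(1,2)] \<rho>(2) c by simp
      moreover have "cell ws (Suc i) \<rho> = Some (T (r, c + 1))"
        using cell_tableau(1)[OF i \<rho>(4,1) col(2)[OF i]] T_eq[OF i r(1,3)] \<rho>(2) c by simp
      ultimately have "flaw ws \<rho> i" using less i \<rho>(4) by (simp add: flaw_def)
      with nf show False by blast
    qed
    moreover have "T \<in> young lam \<rightarrow>\<^sub>E UNIV" by (auto simp: T_def)
    ultimately have "T \<in> SSYT_P lam" by (simp add: SSYT_P_def)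
    moreover have "tableau_columns T = ws"
    proof (rule nth_equalityI)
      fix i assume "i < length (tableau_columns T)"
      then have i: "i < ?k" by (simp add: tableau_columns_def del: upt_Suc)
      show "tableau_columns T ! i = ws ! i"
      proof (rule nth_equalityI)
        fix t assume "t < length (tableau_columns T ! i)"
        then have t: "t < conjp lam (Suc i)" using tableau_columns_nth(1)[OF i] by simp
        then show "tableau_columns T ! i ! t = ws ! i ! t"
          using tableau_columns_nth(2)[OF i t] T_eq[OF i, of "conjp lam (Suc i) - t"] by simp
      qed (simp add: tableau_columns_nth(1)[OF i] col(2)[OF i])
    qed (simp add: tableau_columns_def len del: upt_Suc)
    ultimately show "a \<in> tableau_array ` SSYT_P lam"
      unfolding a tableau_array_def by blast
  qed
qed

lemma pairing_Jfrak_tableaux: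
  assumes "is_partition lam" "pknuth_invariant \<chi>"
  shows "pairing \<chi> (Jfrak lam :: 'a ncpoly) = (\<Sum>T\<in>SSYT_P lam. \<chi> (colword lam T))"
proof -
  let ?f = "\<lambda>(\<pi>, ws). sign \<pi> * \<chi> (concat ws)"
  have split: "arrays lam = flawed \<union> flawless" "flawed \<inter> flawless = {}"
    by (auto simp: flawed_def flawless_def)
  have "finite flawless"
    using finite_arrays[of lam] by (rule rev_finite_subset) (auto simp: flawless_def)
  then have "pairing \<chi> (Jfrak lam :: 'a ncpoly) = sum ?f flawed + sum ?f flawless"
    unfolding pairing_Jfrak split(1) using finite_flawed split(2) by (intro sum.union_disjoint)
  also have "\<dots> = sum ?f flawless" using sum_flawed[OF assms(2)] by simp
  also have "\<dots> = (\<Sum>T\<in>SSYT_P lam. ?f (tableau_array T))"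
    using sum.reindex_bij_betw[OF bij_betw_tableaux[OF assms(1)], of ?f] by simp
  also have "\<dots> = (\<Sum>T\<in>SSYT_P lam. \<chi> (colword lam T))"
    by (simp add: sign_id colword_def tableau_array_def tableau_columns_def del: upt_Suc)
  finally show ?thesis .
qed

end

theorem mainTheorem2:
  assumes "three_plus_one_free TYPE('a::{finite,order})"
    and "is_partition lam"
  shows "(Jfrak lam :: 'a ncpoly) - (\<Sum>T\<in>(SSYT_P lam :: (nat \<times> nat \<Rightarrow> 'a) set). umon (colword lam T))
           \<in> nc_ideal plac_gens"
proof (rule nc_idealI)
  fix \<chi> :: "'a list \<Rightarrow> int"
  assume \<chi>: "pknuth_invariant \<chi>"
  have order: "three_one_free_order ((<) :: 'a \<Rightarrow> 'a \<Rightarrow> bool)"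
    by (rule three_one_free_order_less) fact
  obtain g :: "'a list \<times> 'a list \<Rightarrow> 'a list \<times> 'a list" where g: "column_arrays g"
    using three_one_free_order.chain_pair_swap[OF order] order by (metis column_arrays.intro)
  from column_arrays.pairing_Jfrak_tableaux[OF g assms(2) \<chi>]
  show "pairing \<chi> ((Jfrak lam :: 'a ncpoly)
      - (\<Sum>T\<in>(SSYT_P lam :: (nat \<times> nat \<Rightarrow> 'a) set). umon (colword lam T))) = 0"
    by (simp add: pairing_diff pairing_sum umon_def)
qed

end
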